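(* Let $u_h^0\in V_h^d$ and suppose that $u_h^n\in V_h^d$, $n=1,\dots,N$, solves the fully discrete scheme $$\Big(\sum_{k=1}^{n}\bar c_{n,k}(u_h^k-u_h^{k-1}),v_h\Big)+\kappa_s\mathcal A_h(u_h^n,v_h)=(f^n,v_h)\qquad\forall v_h\in V_h^d,\quad n=1,\dots,N,$$ where $f^n=f(\cdot,t_n)\in L^2(\Omega)$. Then $$\|u_h^n\|\le\frac{1}{\bar c_{n,n}}\Big(\|f^n\|+\bar c_{n,1}\|u_h^0\|+\sum_{k=1}^{n-1}(\bar c_{n,k+1}-\bar c_{n,k})\|u_h^k\|\Big),\qquad n=1,2,\dots,N,$$ where $1/\bar c_{n,n}=\tau_n$.
   Context: Setting. $0<\alpha<1$, $0<s<1$, $\gamma\ge0$, $\kappa_s>0$, $T>0$, $\Omega=\prod_{k=1}^d(a_k,b_k)\subset\mathbb R^d$, $d\in\{1,2,3\}$; $(\cdot,\cdot)$ and $\|\cdot\|$ are the $L^2(\Omega)$ inner product and norm. Space discretization. $V_h^d\subset H_0^1(\Omega)$ is the tensor-product finite element space on a uniform Cartesian mesh of $\Omega$ (continuous, vanishing on $\partial\Omega$; piecewise (multi)linear, or more generally of degree $r\ge1$). $M$ and $S$ are its mass and stiffness matrices, $\pi_h$ is the linear bijection sending a function of $V_h^d$ to its coefficient vector, and $(-\Delta_h+\gamma\mathbb I)^s:=\pi_h^{-1}(M^{-1}S+\gamma I)^s\pi_h$ on $V_h^d$ (the fractional power of the positive, $L^2$-self-adjoint discrete operator, defined spectrally).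 Put $\mathcal A_h(u_h,v_h)=((-\Delta_h+\gamma\mathbb I)^su_h,v_h)$ for $u_h,v_h\in V_h^d$. Time discretization. Graded mesh $t_n=T(n/N)^\omega$, $\omega\ge1$, $n=0,\dots,N$; $\Delta t_n=t_n-t_{n-1}$; $\tau_n=\Delta t_n^\alpha\,\Gamma(2-\alpha)$. Let $Q>1$ be an integer, $w_j=-\frac{\sin(\alpha\pi)}{\pi}\Delta y\,e^{(1+\alpha)y_j}<0$, $\xi_j=-e^{y_j}<0$, $y_j=y_{\min}+(j-1)\Delta y$, $\Delta y=(y_{\max}-y_{\min})/(Q-1)$, $j=1,\dots,Q$, so that $\sum_{j=1}^Q w_je^{\xi_jt}$ approximates $t^{-1-\alpha}/\Gamma(-\alpha)$ on $[t_1,T]$ up to an error $O(\epsilon t^{-1-\alpha})$ with a given small precision $\epsilon>0$. For a sequence $\{\rho(t_k)\}$ define $Y_j(t_0)=0$ and $Y_j(t_i)=e^{z}Y_j(t_{i-1})+\frac1{\xi_j}\big(e^z-1-\frac{e^z-z-1}{z}\big)\rho(t_{i-1})+\frac1{\xi_j}\frac{e^z-z-1}{z}\rho(t_i)$ with $z=\xi_j\Delta t_i$. Define the coefficients $b_k^n$ by $$\sum_{k=0}^nb_k^n\rho(t_k)=\frac{\rho(t_n)-\alpha\rho(t_{n-1})-(1-\alpha)(\Delta t_n/t_n)^\alpha\rho(t_0)}{\tau_n}+\sum_{j=1}^Qw_je^{\xi_j\Delta t_n}Y_j(t_{n-1}),$$ (the last sum is zero for $n=1$), and set $\bar c_{n,1}=-b_0^n$,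 $\bar c_{n,k}=\bar c_{n,k-1}-b_{k-1}^n$ for $2\le k\le n-1$, and $\bar c_{n,n}=b_n^n=1/\tau_n$. Standing property of these coefficients (taken as given): $\bar c_{n,n}\ge\bar c_{n,n-1}\ge\cdots\ge\bar c_{n,1}\ge\frac{t_n^{-\alpha}}{\Gamma(1-\alpha)}>0$ for all $n$. *)

theory Defs
  imports
    "HOL-Analysis.Analysis"
    "Jordan_Normal_Form.Gauss_Jordan_Elimination"
begin

no_notation Matrix.vec_index (infixl "$" 100)

definition L2_space :: "'a::euclidean_space set \<Rightarrow> ('a \<Rightarrow> real) set" where
  "L2_space \<Omega> = {f. f \<in> borel_measurable (lebesgue_on \<Omega>) \<and>
                    integrable (lebesgue_on \<Omega>) (\<lambda>x. (f x)\<^sup>2)}"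

definition L2_inner :: "'a::euclidean_space set \<Rightarrow> ('a \<Rightarrow> real) \<Rightarrow> ('a \<Rightarrow> real) \<Rightarrow> real" where
  "L2_inner \<Omega> f g = (LINT x|lebesgue_on \<Omega>. f x * g x)"

definition L2_norm :: "'a::euclidean_space set \<Rightarrow> ('a \<Rightarrow> real) \<Rightarrow> real" where
  "L2_norm \<Omega> f = sqrt (L2_inner \<Omega> f f)"

text \<open>Elements of the finite element spaces are extended by zero outside the domain, so that they
  are determined as functions by their restriction to it. The mesh has \<open>m\<close> cells of equal length
  in one dimension, and \<open>m k\<close> cells in direction \<open>k\<close> in several dimensions.\<close>

definition fe_space_1d :: "nat \<Rightarrow> nat \<Rightarrow> real \<Rightarrow> real \<Rightarrow> (real \<Rightarrow> real) set" where
  "fe_space_1d r m a b = {v. continuous_on UNIV v \<and> (\<forall>x. x \<notin> {a<..<b} \<longrightarrow> v x = 0) \<and>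
     (\<forall>i<m. \<exists>p. degree p \<le> r \<and>
        (\<forall>x \<in> {a + real i * ((b - a) / real m) .. a + real (Suc i) * ((b - a) / real m)}.
           v x = poly p x))}"

text \<open>The span of the products of one-dimensional functions. Scalar coefficients are absorbed in
  the factors.\<close>

definition fe_space :: "nat \<Rightarrow> ('d::finite \<Rightarrow> nat) \<Rightarrow> real^'d \<Rightarrow> real^'d \<Rightarrow> (real^'d \<Rightarrow> real) set" where
  "fe_space r m a b = {v. \<exists>(J::nat) \<phi>.
     (\<forall>j<J. \<forall>k. \<phi> j k \<in> fe_space_1d r (m k) (a $ k) (b $ k)) \<and>
     v = (\<lambda>x. \<Sum>j<J. \<Prod>k\<in>UNIV. \<phi> j k (x $ k))}"

text \<open>A finite element function is piecewise polynomial, so its classical partial derivative exists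
  off a null set and represents the weak one.\<close>

definition partial_deriv :: "'d::finite \<Rightarrow> (real^'d \<Rightarrow> real) \<Rightarrow> real^'d \<Rightarrow> real" where
  "partial_deriv k v x = deriv (\<lambda>h. v (x + h *\<^sub>R axis k 1)) 0"

definition lin_comb :: "('a \<Rightarrow> real) list \<Rightarrow> real Matrix.vec \<Rightarrow> 'a \<Rightarrow> real" where
  "lin_comb \<phi> c = (\<lambda>x. \<Sum>i<length \<phi>. vec_index c i * (\<phi> ! i) x)"

definition is_fun_basis :: "('a \<Rightarrow> real) list \<Rightarrow> ('a \<Rightarrow> real) set \<Rightarrow> bool" where
  "is_fun_basis \<phi> V \<longleftrightarrow> bij_betw (lin_comb \<phi>) (carrier_vec (length \<phi>)) V"

text \<open>The map \<open>\<pi>\<^sub>h\<close>; its inverse is \<^const>\<open>lin_comb\<close>.\<close>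

definition coords :: "('a \<Rightarrow> real) list \<Rightarrow> ('a \<Rightarrow> real) \<Rightarrow> real Matrix.vec" where
  "coords \<phi> = inv_into (carrier_vec (length \<phi>)) (lin_comb \<phi>)"

definition mass_matrix :: "(real^'d) set \<Rightarrow> (real^'d::finite \<Rightarrow> real) list \<Rightarrow> real Matrix.mat" where
  "mass_matrix \<Omega> \<phi> = Matrix.mat (length \<phi>) (length \<phi>) (\<lambda>(i, j). L2_inner \<Omega> (\<phi> ! j) (\<phi> ! i))"

definition stiffness_matrix :: "(real^'d) set \<Rightarrow> (real^'d::finite \<Rightarrow> real) list \<Rightarrow> real Matrix.mat" where
  "stiffness_matrix \<Omega> \<phi> = Matrix.mat (length \<phi>) (length \<phi>)
     (\<lambda>(i, j). \<Sum>k\<in>UNIV. L2_inner \<Omega> (partial_deriv k (\<phi> ! j)) (partial_deriv k (\<phi> ! i)))"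

text \<open>Spectral power: \<open>(P diag(l) P\<^sup>-\<^sup>1)\<^sup>s = P diag(l\<^sup>s) P\<^sup>-\<^sup>1\<close>. The right-hand side does
  not depend on the diagonalization. Meaningful only for matrices that are diagonalizable over the
  reals with nonnegative eigenvalues.\<close>

definition mat_powr :: "real Matrix.mat \<Rightarrow> real \<Rightarrow> real Matrix.mat" where
  "mat_powr A s = (THE B. \<exists>P Q l. (\<forall>i<dim_row A. 0 \<le> l i) \<and>
     similar_mat_wit A (mat_diag (dim_row A) l) P Q \<and>
     B = P * mat_diag (dim_row A) (\<lambda>i. l i powr s) * Q)"

definition frac_op ::
    "(real^'d) set \<Rightarrow> (real^'d::finite \<Rightarrow> real) list \<Rightarrow> real \<Rightarrow> real \<Rightarrow> (real^'d \<Rightarrow> real) \<Rightarrow> real^'d \<Rightarrow> real" where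
  "frac_op \<Omega> \<phi> \<gamma> s u =
     lin_comb \<phi>
       (mat_powr (the (mat_inverse (mass_matrix \<Omega> \<phi>)) * stiffness_matrix \<Omega> \<phi> + \<gamma> \<cdot>\<^sub>m 1\<^sub>m (length \<phi>)) s
          *\<^sub>v coords \<phi> u)"

definition frac_form ::
    "(real^'d) set \<Rightarrow> (real^'d::finite \<Rightarrow> real) list \<Rightarrow> real \<Rightarrow> real \<Rightarrow>
     (real^'d \<Rightarrow> real) \<Rightarrow> (real^'d \<Rightarrow> real) \<Rightarrow> real" where
  "frac_form \<Omega> \<phi> \<gamma> s u v = L2_inner \<Omega> (frac_op \<Omega> \<phi> \<gamma> s u) v"

text \<open>Below, a grid function is a sequence \<open>\<rho>\<close>, with \<open>\<rho> k\<close> its value at \<open>t k\<close>, and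
  \<open>soe_hist \<xi> t \<rho> i\<close> is the history variable \<open>Y(t\<^sub>i)\<close> of the exponential with rate \<open>\<xi>\<close>.\<close>

definition graded_mesh :: "real \<Rightarrow> real \<Rightarrow> nat \<Rightarrow> nat \<Rightarrow> real" where
  "graded_mesh T \<omega> N n = T * (real n / real N) powr \<omega>"

definition time_step :: "(nat \<Rightarrow> real) \<Rightarrow> nat \<Rightarrow> real" where
  "time_step t n = t n - t (n - 1)"

definition step_tau :: "real \<Rightarrow> (nat \<Rightarrow> real) \<Rightarrow> nat \<Rightarrow> real" where
  "step_tau \<alpha> t n = time_step t n powr \<alpha> * Gamma (2 - \<alpha>)"

definition soe_dy :: "real \<Rightarrow> real \<Rightarrow> nat \<Rightarrow> real" where
  "soe_dy ymin ymax Q = (ymax - ymin) / (real Q - 1)"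

definition soe_y :: "real \<Rightarrow> real \<Rightarrow> nat \<Rightarrow> nat \<Rightarrow> real" where
  "soe_y ymin ymax Q j = ymin + (real j - 1) * soe_dy ymin ymax Q"

definition soe_weight :: "real \<Rightarrow> real \<Rightarrow> real \<Rightarrow> nat \<Rightarrow> nat \<Rightarrow> real" where
  "soe_weight \<alpha> ymin ymax Q j =
     - (sin (\<alpha> * pi) / pi) * soe_dy ymin ymax Q * exp ((1 + \<alpha>) * soe_y ymin ymax Q j)"

definition soe_node :: "real \<Rightarrow> real \<Rightarrow> nat \<Rightarrow> nat \<Rightarrow> real" where
  "soe_node ymin ymax Q j = - exp (soe_y ymin ymax Q j)"

primrec soe_hist :: "real \<Rightarrow> (nat \<Rightarrow> real) \<Rightarrow> (nat \<Rightarrow> real) \<Rightarrow> nat \<Rightarrow> real" where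
  "soe_hist \<xi> t \<rho> 0 = 0"
| "soe_hist \<xi> t \<rho> (Suc i) =
    (let z = \<xi> * time_step t (Suc i) in
       exp z * soe_hist \<xi> t \<rho> i
       + 1 / \<xi> * (exp z - 1 - (exp z - z - 1) / z) * \<rho> i
       + 1 / \<xi> * ((exp z - z - 1) / z) * \<rho> (Suc i))"

definition fast_caputo ::
    "real \<Rightarrow> (nat \<Rightarrow> real) \<Rightarrow> nat \<Rightarrow> (nat \<Rightarrow> real) \<Rightarrow> (nat \<Rightarrow> real) \<Rightarrow> nat \<Rightarrow> (nat \<Rightarrow> real) \<Rightarrow> real" where
  "fast_caputo \<alpha> t Q w \<xi> n \<rho> =
     (\<rho> n - \<alpha> * \<rho> (n - 1) - (1 - \<alpha>) * (time_step t n / t n) powr \<alpha> * \<rho> 0) / step_tau \<alpha> t n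
     + (\<Sum>j=1..Q. w j * exp (\<xi> j * time_step t n) * soe_hist (\<xi> j) t \<rho> (n - 1))"

text \<open>The coefficients \<open>c\<^sub>n\<^sub>,\<^sub>k\<close> for \<open>1 \<le> k \<le> n\<close>. The value \<open>0\<close> at \<open>k = 0\<close> only serves to start
  the recursion at \<open>c\<^sub>n\<^sub>,\<^sub>1 = - b\<^sub>n\<^sub>,\<^sub>0\<close>.\<close>

primrec cbar :: "(nat \<Rightarrow> nat \<Rightarrow> real) \<Rightarrow> nat \<Rightarrow> nat \<Rightarrow> real" where
  "cbar b n 0 = 0"
| "cbar b n (Suc k) = (if Suc k = n then b n n else cbar b n k - b n k)"

end

theory Submission
  imports Defs
    "Jordan_Normal_Form.Jordan_Normal_Form_Existence"
    "Jordan_Normal_Form.Jordan_Normal_Form_Uniqueness"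
begin

no_notation Matrix.vec_index (infixl "$" 100)

text \<open>The estimate is an energy argument: the scheme is tested with \<open>v = u\<^sup>n\<close>. Summation by parts
(\<open>sum_by_parts\<close>) turns the discrete time derivative into \<open>c\<^sub>n\<^sub>,\<^sub>n \<parallel>u\<^sup>n\<parallel>\<^sup>2\<close> minus inner products of
\<open>u\<^sup>n\<close> with the earlier \<open>u\<^sup>k\<close>. Their weights \<open>c\<^sub>n\<^sub>,\<^sub>1\<close> and \<open>c\<^sub>n\<^sub>,\<^sub>k\<^sub>+\<^sub>1 - c\<^sub>n\<^sub>,\<^sub>k\<close> are nonnegative, so
the Cauchy-Schwarz inequality bounds each term separately. The fractional term
\<open>\<kappa> ((-\<Delta>\<^sub>h + \<gamma>)\<^sup>s u\<^sup>n, u\<^sup>n)\<close> is nonnegative and is dropped, and one factor \<open>\<parallel>u\<^sup>n\<parallel>\<close> is cancelled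
(\<open>energy_estimate\<close>).

The substance is the nonnegativity of the fractional term (\<open>frac_form_nonneg\<close>). The matrix
\<open>A = M\<^sup>-\<^sup>1 S + \<gamma> I\<close> is not symmetric, but it is self-adjoint for the inner product
\<open>x \<bullet> M y\<close>, because \<open>M A = S + \<gamma> M\<close> is symmetric. Hence its characteristic polynomial has only
real roots and its generalized eigenvectors are eigenvectors, so all its Jordan blocks have size one:
\<open>A\<close> is diagonalizable over the reals (\<open>diagonalizable\<close>). Its eigenvalues are nonnegative, because
\<open>M A\<close> is positive semidefinite. A function of \<open>A\<close> formed on its eigenvalues does not depend on the
diagonalization (\<open>diag_fun_unique\<close>) and is again self-adjoint (\<open>diag_fun_symmetric\<close>), so that
\<open>x \<bullet> M A\<^sup>s x = (A\<^bsup>s/2\<^esup> x) \<bullet> M (A\<^bsup>s/2\<^esup> x) \<ge> 0\<close>.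

That \<open>M\<close> is positive definite and \<open>S\<close> positive semidefinite is a statement about integrals of finite
element functions: these and their classical partial derivatives are square integrable
(\<open>fe_space_L2\<close>, \<open>fe_space_partial_deriv_L2\<close>), and a finite element function of norm zero vanishes
identically because it is continuous (\<open>fe_space_definite\<close>).\<close>

section \<open>Matrices that are self-adjoint for a weighted inner product\<close>

text \<open>Self-adjointness of \<open>A\<close> for the inner product \<open>x \<bullet> M y\<close> is expressed by the symmetry of \<open>M A\<close>.\<close>

locale mass_selfadjoint =
  fixes n :: nat and M A :: "real Matrix.mat"
  assumes M: "M \<in> carrier_mat n n" and A: "A \<in> carrier_mat n n"
    and M_sym: "transpose_mat M = M"
    and MA_sym: "transpose_mat (M * A) = M * A"
    and M_pos: "\<And>x. x \<in> carrier_vec n \<Longrightarrow> x \<noteq> 0\<^sub>v n \<Longrightarrow> 0 < scalar_prod x (M *\<^sub>v x)"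
begin

lemma M_nonneg: "x \<in> carrier_vec n \<Longrightarrow> 0 \<le> scalar_prod x (M *\<^sub>v x)"
  using M_pos[of x] M by (cases "x = 0\<^sub>v n") auto

lemma sym_swap:
  assumes B: "B \<in> carrier_mat n n" "transpose_mat B = B"
    and x: "x \<in> carrier_vec n" and y: "(y :: real Matrix.vec) \<in> carrier_vec n"
  shows "scalar_prod x (B *\<^sub>v y) = scalar_prod y (B *\<^sub>v x)"
proof -
  have "scalar_prod (transpose_mat B *\<^sub>v y) x = scalar_prod y (B *\<^sub>v x)"
    by (rule transpose_vec_mult_scalar[OF B(1) x y])
  thus ?thesis using B x y by (simp add: comm_scalar_prod[of x n])
qed

text \<open>The usual argument for Hermitian matrices, in real terms: for an eigenvector \<open>x + i y\<close>, symmetry of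
\<open>x \<bullet> M A y\<close> in \<open>x\<close> and \<open>y\<close> forces \<open>Im e (x \<bullet> M x + y \<bullet> M y) = 0\<close>.\<close>

lemma complex_eigenvalue_real:
  assumes "eigenvalue (map_mat complex_of_real A) e"
  shows "Im e = 0"
proof -
  let ?C = "map_mat complex_of_real A"
  obtain v where v: "v \<in> carrier_vec n" "v \<noteq> 0\<^sub>v n" "?C *\<^sub>v v = e \<cdot>\<^sub>v v"
    using assms A by (auto simp: eigenvalue_def eigenvector_def)
  define x where "x = map_vec Re v"
  define y where "y = map_vec Im v"
  have x: "x \<in> carrier_vec n" and y: "y \<in> carrier_vec n"
    using v(1) by (auto simp: x_def y_def)
  have comp: "(\<Sum>j<n. complex_of_real (A $$ (i,j)) * vec_index v j) = e * vec_index v i"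
    if "i < n" for i
    using arg_cong[OF v(3), of "\<lambda>u. vec_index u i"] that v(1) A
    by (simp add: scalar_prod_def atLeast0LessThan)
  have Ax: "A *\<^sub>v x = Re e \<cdot>\<^sub>v x + (- Im e) \<cdot>\<^sub>v y"
    using A x y v(1) arg_cong[OF comp, of _ Re]
    by (intro eq_vecI) (auto simp: scalar_prod_def atLeast0LessThan x_def y_def)
  have Ay: "A *\<^sub>v y = Im e \<cdot>\<^sub>v x + Re e \<cdot>\<^sub>v y"
    using A x y v(1) arg_cong[OF comp, of _ Im]
    by (intro eq_vecI) (auto simp: scalar_prod_def atLeast0LessThan x_def y_def)
  have cx: "M *\<^sub>v x \<in> carrier_vec n" and cy: "M *\<^sub>v y \<in> carrier_vec n"
    using M x y by auto
  have MAx: "M *\<^sub>v (A *\<^sub>v x) = Re e \<cdot>\<^sub>v (M *\<^sub>v x) + (- Im e) \<cdot>\<^sub>v (M *\<^sub>v y)"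
    unfolding Ax using M x y by (simp add: mult_add_distrib_mat_vec[OF M] mult_mat_vec[OF M])
  have MAy: "M *\<^sub>v (A *\<^sub>v y) = Im e \<cdot>\<^sub>v (M *\<^sub>v x) + Re e \<cdot>\<^sub>v (M *\<^sub>v y)"
    unfolding Ay using M x y by (simp add: mult_add_distrib_mat_vec[OF M] mult_mat_vec[OF M])
  have "scalar_prod y (M *\<^sub>v (A *\<^sub>v x)) = scalar_prod x (M *\<^sub>v (A *\<^sub>v y))"
    using sym_swap[OF _ MA_sym y x] M A x y by simp
  moreover have "scalar_prod y (M *\<^sub>v x) = scalar_prod x (M *\<^sub>v y)"
    by (rule sym_swap[OF M M_sym y x])
  ultimately have "Im e * (scalar_prod x (M *\<^sub>v x) + scalar_prod y (M *\<^sub>v y)) = 0"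
    unfolding MAx MAy using x y cx cy
    by (simp add: scalar_prod_add_distrib[of _ n] algebra_simps)
  moreover have "scalar_prod x (M *\<^sub>v x) + scalar_prod y (M *\<^sub>v y) > 0"
  proof -
    have "x \<noteq> 0\<^sub>v n \<or> y \<noteq> 0\<^sub>v n"
    proof (rule ccontr)
      assume "\<not> ?thesis"
      hence z: "x = 0\<^sub>v n" "y = 0\<^sub>v n" by auto
      have "v = 0\<^sub>v n"
      proof (rule eq_vecI)
        fix i assume i: "i < dim_vec (0\<^sub>v n :: complex Matrix.vec)"
        have "vec_index x i = 0" "vec_index y i = 0" using i by (auto simp: z)
        thus "vec_index v i = vec_index (0\<^sub>v n) i"
          using i v(1) by (auto simp: x_def y_def complex_eq_iff)
      qed (use v in auto)
      with v show False by simp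
    qed
    thus ?thesis using M_pos[of x] M_pos[of y] M_nonneg[OF x] M_nonneg[OF y] x y by fastforce
  qed
  ultimately show ?thesis by simp
qed

text \<open>Over the complex numbers the characteristic polynomial splits, and its roots are real; the
factorization therefore descends along the embedding of the real polynomials.\<close>

lemma char_poly_splits: "\<exists>as. char_poly A = (\<Prod>a\<leftarrow>as. [:- a, 1:])"
proof -
  let ?C = "map_mat complex_of_real A"
  have C: "?C \<in> carrier_mat n n" using A by simp
  obtain as where as: "char_poly ?C = (\<Prod>a\<leftarrow>as. [:- a, 1:])"
    using char_poly_factorized[OF C] by blast
  have re: "complex_of_real (Re a) = a" if "a \<in> set as" for a
  proof -
    have "poly (char_poly ?C) a = 0"
      using that unfolding as by (induct as) auto
    hence "eigenvalue ?C a" using eigenvalue_root_char_poly[OF C] by simp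
    thus ?thesis using complex_eigenvalue_real by (simp add: complex_eq_iff)
  qed
  interpret h: inj_comm_ring_hom complex_of_real
    by unfold_locales auto
  interpret hp: map_poly_inj_comm_ring_hom complex_of_real ..
  have "map_poly complex_of_real (\<Prod>a\<leftarrow>map Re as. [:- a, 1:]) = (\<Prod>a\<leftarrow>as. [:- a, 1:])"
    using re
  proof (induct as)
    case (Cons a as)
    have "map_poly complex_of_real [:- Re a, 1:] = [:- a, 1:]"
      using Cons(2)[of a] by simp
    with Cons show ?case by (simp only: list.map prod_list.Cons hp.hom_mult) simp
  qed simp
  also have "\<dots> = map_poly complex_of_real (char_poly A)"
    using as of_real_hom.char_poly_hom[OF A, where ?'a = complex] by simp
  finally show ?thesis using hp.injectivity by metis
qed

text \<open>With \<open>B = A - e I\<close>, also self-adjoint, \<open>B B x = 0\<close> gives \<open>B x \<bullet> M B x = x \<bullet> M B B x = 0\<close>, so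
generalized eigenvectors are eigenvectors.\<close>

lemma char_matrix_sq_kernel:
  assumes x: "x \<in> carrier_vec n" and 0: "char_matrix A e *\<^sub>v (char_matrix A e *\<^sub>v x) = 0\<^sub>v n"
  shows "char_matrix A e *\<^sub>v x = 0\<^sub>v n"
proof (rule ccontr)
  let ?B = "char_matrix A e"
  assume ne: "?B *\<^sub>v x \<noteq> 0\<^sub>v n"
  have B: "?B \<in> carrier_mat n n" using A by simp
  have MB: "M * ?B = M * A + (- e) \<cdot>\<^sub>m M"
    unfolding char_matrix_def using A M
    by (simp add: mult_add_distrib_mat[OF M A] mult_smult_distrib[OF M one_carrier_mat])
  have transpose_smult: "transpose_mat (c \<cdot>\<^sub>m M) = c \<cdot>\<^sub>m transpose_mat M" for c
    by (intro eq_matI) auto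
  have MBsym: "transpose_mat (M * ?B) = M * ?B"
    unfolding MB using M A MA_sym M_sym
    by (simp add: transpose_add[of _ n n] transpose_smult)
  have MBc: "M * ?B \<in> carrier_mat n n" using M B by simp
  have M0: "M *\<^sub>v 0\<^sub>v n = 0\<^sub>v n"
    using M by (intro eq_vecI) auto
  have Bx: "?B *\<^sub>v x \<in> carrier_vec n" using B x by simp
  have "scalar_prod (?B *\<^sub>v x) ((M * ?B) *\<^sub>v x) = scalar_prod x ((M * ?B) *\<^sub>v (?B *\<^sub>v x))"
    by (rule sym_swap[OF MBc MBsym Bx x])
  also have "(M * ?B) *\<^sub>v (?B *\<^sub>v x) = 0\<^sub>v n"
    using 0 M B Bx by (simp add: M0)
  finally have "scalar_prod (?B *\<^sub>v x) (M *\<^sub>v (?B *\<^sub>v x)) = 0"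
    using M B x by simp
  with M_pos[OF Bx ne] show False by simp
qed

lemma gen_eigenspace_eq: "dim_gen_eigenspace A e 2 = dim_gen_eigenspace A e 1"
proof -
  let ?B = "char_matrix A e"
  have B: "?B \<in> carrier_mat n n" using A by simp
  have B2: "?B ^\<^sub>m 2 = ?B * ?B" using B by (simp add: numeral_2_eq_2)
  have "mat_kernel (?B ^\<^sub>m 2) = mat_kernel (?B ^\<^sub>m 1)"
    using char_matrix_sq_kernel[of _ e] B unfolding mat_kernel_def B2
    by auto
  thus ?thesis using B unfolding dim_gen_eigenspace_def kernel_dim_def B2
    by simp
qed

end

lemma jordan_matrix_size_one:
  assumes "\<forall>p\<in>set n_as. fst p = 1"
  shows "jordan_matrix n_as = mat_diag (length n_as) (\<lambda>i. snd (n_as ! i))"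
  using assms
proof (induct n_as)
  case Nil
  show ?case by (intro eq_matI) (auto simp: jordan_matrix_def mat_diag_def)
next
  case (Cons p n_as)
  obtain a where p: "p = (1, a)" using Cons(2) by (cases p) auto
  have IH: "diag_block_mat (map (\<lambda>(x, y). jordan_block x y) n_as)
      = mat_diag (length n_as) (\<lambda>i. snd (n_as ! i))"
    using Cons unfolding jordan_matrix_def by auto
  show ?case unfolding p jordan_matrix_def
    by (intro eq_matI) (auto simp: Let_def IH mat_diag_def nth_Cons' jordan_block_def)
qed

section \<open>Functions of a diagonalizable self-adjoint matrix\<close>

text \<open>Entrywise, the hypothesis says that \<open>l i = k j\<close> wherever \<open>W\<close> has a nonzero entry, and this survives
the application of any \<open>g\<close>. It replaces the usual interpolation of \<open>g\<close> by a polynomial.\<close>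

lemma mat_diag_intertwine:
  fixes W :: "real Matrix.mat"
  assumes W: "W \<in> carrier_mat n n" and eq: "mat_diag n l * W = W * mat_diag n k"
  shows "mat_diag n (\<lambda>i. g (l i)) * W = W * mat_diag n (\<lambda>i. g (k i))"
proof -
  have "l i * W $$ (i, j) = W $$ (i, j) * k j" if "i < n" "j < n" for i j
    using arg_cong[OF eq, of "\<lambda>X. X $$ (i, j)"] that
    unfolding mat_diag_mult_left[OF W] mat_diag_mult_right[OF W] by simp
  hence "W $$ (i, j) \<noteq> 0 \<Longrightarrow> l i = k j" if "i < n" "j < n" for i j
    using that by (metis mult.commute mult_cancel_left)
  hence "g (l i) * W $$ (i, j) = W $$ (i, j) * g (k j)" if "i < n" "j < n" for i j
    using that by (cases "W $$ (i, j) = 0") auto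
  thus ?thesis unfolding mat_diag_mult_left[OF W] mat_diag_mult_right[OF W]
    by (intro eq_matI) auto
qed

text \<open>The change of basis \<open>Q P'\<close> between two diagonalizations intertwines the two diagonal matrices.\<close>

lemma diag_fun_unique:
  assumes A: "A \<in> carrier_mat n n"
    and w1: "similar_mat_wit A (mat_diag n (l :: nat \<Rightarrow> real)) P Q"
    and w2: "similar_mat_wit A (mat_diag n k) P' Q'"
  shows "P * mat_diag n (\<lambda>i. g (l i)) * Q = P' * mat_diag n (\<lambda>i. g (k i)) * Q'"
proof -
  note W = similar_mat_witD2[OF A w1]
  note V = similar_mat_witD2[OF A w2]
  note as = assoc_mult_mat[of _ n n _ n _ n] mult_carrier_mat[of _ n n _ n] right_mult_one_mat[of _ n n]
  let ?D = "mat_diag n l" and ?E = "mat_diag n k"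
  let ?gD = "mat_diag n (\<lambda>i. g (l i))" and ?gE = "mat_diag n (\<lambda>i. g (k i))"
  have c: "Q * P' \<in> carrier_mat n n" using W V by simp
  have cancel: "P * (Q * X) = X" "Q * (P * X) = X" "P' * (Q' * X) = X" "Q' * (P' * X) = X"
    if "X \<in> carrier_mat n n" for X
    using that W V by (simp_all flip: as(1)[of P Q X] as(1)[of Q P X] as(1)[of P' Q' X] as(1)[of Q' P' X])
  have "?D * (Q * P') = Q * (P * ?D * Q) * P'"
    using W(4-) V(4-) cancel by (simp add: as)
  also have "\<dots> = Q * (P' * ?E * Q') * P'"
    using W(3) V(3) by simp
  also have "\<dots> = (Q * P') * ?E"
    using W(4-) V(1,2,4-) cancel by (simp add: as)
  finally have "?D * (Q * P') = (Q * P') * ?E" .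
  from mat_diag_intertwine[OF c this]
  have e: "?gD * (Q * P') = (Q * P') * ?gE" .
  have "P * ?gD * Q = P * (?gD * (Q * P')) * Q'"
    using W(4-) V(1,2,4-) cancel by (simp add: as)
  also have "\<dots> = P' * ?gE * Q'"
    unfolding e using W(4-) V(1,2,4-) cancel by (simp add: as)
  finally show ?thesis .
qed

lemma mat_powr_eq:
  assumes A: "A \<in> carrier_mat n n"
    and w: "similar_mat_wit A (mat_diag n l) P Q" and l: "\<forall>i<n. 0 \<le> l i"
  shows "mat_powr A s = P * mat_diag n (\<lambda>i. l i powr s) * Q"
  unfolding mat_powr_def
proof (rule the_equality)
  have d: "dim_row A = n" using A by simp
  show "\<exists>P' Q' k. (\<forall>i<dim_row A. 0 \<le> k i) \<and>
     similar_mat_wit A (mat_diag (dim_row A) k) P' Q' \<and>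
     P * mat_diag n (\<lambda>i. l i powr s) * Q = P' * mat_diag (dim_row A) (\<lambda>i. k i powr s) * Q'"
    unfolding d using w l by blast
  fix B
  assume "\<exists>P Q l. (\<forall>i<dim_row A. 0 \<le> l i) \<and>
     similar_mat_wit A (mat_diag (dim_row A) l) P Q \<and>
     B = P * mat_diag (dim_row A) (\<lambda>i. l i powr s) * Q"
  thus "B = P * mat_diag n (\<lambda>i. l i powr s) * Q"
    unfolding d using diag_fun_unique[OF A _ w, of _ _ _ "\<lambda>t. t powr s"] by blast
qed

context mass_selfadjoint begin

text \<open>A Jordan block of size \<open>k\<close> contributes \<open>min 2 k\<close> to the dimension of the second generalized
eigenspace and \<open>min 1 k\<close> to that of the eigenspace. These dimensions agree, so no block is larger
than one.\<close>

lemma diagonalizable: "\<exists>l P Q. similar_mat_wit A (mat_diag n l) P Q"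
proof -
  obtain n_as where jnf: "jordan_nf A n_as"
    using char_poly_splits jordan_nf_exists[OF A] by blast
  have "fst p = 1" if p: "p \<in> set n_as" for p
  proof -
    let ?xs = "map fst [(n, e)\<leftarrow>n_as. e = snd p]"
    have "(\<Sum>n\<leftarrow>?xs. min 2 n) = (\<Sum>n\<leftarrow>?xs. min 1 n)"
      using gen_eigenspace_eq[of "snd p"] unfolding dim_gen_eigenspace[OF jnf] .
    moreover have "fst p \<in> set ?xs" using p by force
    moreover have "min 2 k = min 1 k" if "(\<Sum>n\<leftarrow>ys. min 2 n) = (\<Sum>n\<leftarrow>ys. min 1 n)" "k \<in> set ys"
      for ys :: "nat list" and k
    proof -
      have le: "(\<Sum>n\<leftarrow>zs. min 1 n) \<le> (\<Sum>n\<leftarrow>zs. min 2 n)" for zs :: "nat list"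
        by (rule sum_list_mono) auto
      show ?thesis using that
      proof (induct ys)
        case (Cons z ys)
        have "min 1 z \<le> min 2 z" by simp
        with Cons(2) le[of ys] have "min 2 z = min 1 z" "(\<Sum>n\<leftarrow>ys. min 2 n) = (\<Sum>n\<leftarrow>ys. min 1 n)"
          by (simp_all del: min.bounded_iff)
        with Cons show ?case by auto
      qed simp
    qed
    ultimately have "min 2 (fst p) = min 1 (fst p)" by blast
    moreover have "fst p \<noteq> 0" using p jnf unfolding jordan_nf_def by force
    ultimately show ?thesis by (auto simp: min_def split: if_splits)
  qed
  hence J: "jordan_matrix n_as = mat_diag (length n_as) (\<lambda>i. snd (n_as ! i))"
    by (intro jordan_matrix_size_one) auto
  obtain P Q where w: "similar_mat_wit A (jordan_matrix n_as) P Q"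
    using jnf unfolding jordan_nf_def similar_mat_def by blast
  have "length n_as = n"
    using carrier_matD(1)[OF similar_mat_witD2(5)[OF A w]] by (simp add: J mat_diag_def)
  thus ?thesis using w unfolding J by auto
qed


lemma eigenvalues_nonneg:
  assumes w: "similar_mat_wit A (mat_diag n l) P Q"
    and MA_nonneg: "\<And>x. x \<in> carrier_vec n \<Longrightarrow> 0 \<le> scalar_prod x (M *\<^sub>v (A *\<^sub>v x))"
    and i: "i < n"
  shows "0 \<le> l i"
proof -
  note W = similar_mat_witD2[OF A w]
  let ?p = "col P i"
  have p: "?p \<in> carrier_vec n" using W i by auto
  have "A * P = P * mat_diag n l * (Q * P)"
    using W by (simp add: assoc_mult_mat[of _ n n _ n _ n] mult_carrier_mat[of _ n n _ n] right_mult_one_mat[of _ n n])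
  also have "\<dots> = P * mat_diag n l"
    using W by (simp add: mult_carrier_mat[of _ n n _ n] right_mult_one_mat[of _ n n])
  finally have AP: "A * P = P * mat_diag n l" .
  have "A *\<^sub>v ?p = col (A * P) i"
    using W i by (intro eq_vecI) auto
  also have "\<dots> = l i \<cdot>\<^sub>v ?p"
    unfolding AP mat_diag_mult_right[OF W(6)] using W i by (intro eq_vecI) auto
  finally have Ap: "A *\<^sub>v ?p = l i \<cdot>\<^sub>v ?p" .
  have "?p \<noteq> 0\<^sub>v n"
  proof
    assume z: "?p = 0\<^sub>v n"
    have "col (Q * P) i = Q *\<^sub>v ?p"
      using W(4-) i by (intro eq_vecI) auto
    also have "\<dots> = 0\<^sub>v n" using W(4-) unfolding z by (intro eq_vecI) auto
    finally have "col (1\<^sub>m n) i = (0\<^sub>v n :: real Matrix.vec)" using W(2) by simp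
    hence "vec_index (col (1\<^sub>m n) i) i = (0 :: real)" using i by simp
    thus False using i by simp
  qed
  hence "0 < scalar_prod ?p (M *\<^sub>v ?p)" using M_pos p by blast
  moreover have "0 \<le> l i * scalar_prod ?p (M *\<^sub>v ?p)"
    using MA_nonneg[OF p] p M unfolding Ap by (simp add: mult_mat_vec[OF M])
  ultimately show ?thesis by (simp add: zero_le_mult_iff)
qed

text \<open>The eigenvector matrix \<open>P\<close> need not be orthogonal for \<open>M\<close>. But its Gram matrix \<open>G = P\<^sup>T M P\<close>
commutes with the diagonal matrix of eigenvalues, because \<open>M A\<close> is symmetric, and hence with every
function of that matrix; this commutation is the symmetry claimed.\<close>

lemma diag_fun_symmetric:
  assumes w: "similar_mat_wit A (mat_diag n l) P Q"
  shows "transpose_mat (M * (P * mat_diag n (\<lambda>i. g (l i)) * Q))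
    = M * (P * mat_diag n (\<lambda>i. g (l i)) * Q)"
proof -
  note W = similar_mat_witD2[OF A w]
  note as = assoc_mult_mat[of _ n n _ n _ n] mult_carrier_mat[of _ n n _ n] right_mult_one_mat[of _ n n]
  let ?D = "mat_diag n l" and ?E = "mat_diag n (\<lambda>i. g (l i))"
  let ?Pt = "transpose_mat P" and ?Qt = "transpose_mat Q"
  have tD: "transpose_mat (mat_diag n f) = mat_diag n f" for f :: "nat \<Rightarrow> real"
    by (intro eq_matI) (auto simp: mat_diag_def)
  define G where "G = ?Pt * (M * P)"
  have G: "G \<in> carrier_mat n n" using W M unfolding G_def by simp
  have Gt: "transpose_mat G = G"
    unfolding G_def using W M M_sym by (simp add: transpose_mult[of _ n n _ n] as)
  have QtPt: "?Qt * ?Pt = 1\<^sub>m n"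
    using W transpose_mult[OF W(6,7)] by simp
  \<comment> \<open>The factor \<open>G\<close> is brought in so that the diagonal matrix can be moved past it.\<close>
  have PG: "?Qt * G = M * P"
  proof -
    have "?Qt * G = (?Qt * ?Pt) * (M * P)" unfolding G_def using W M by (simp add: as)
    thus ?thesis using W M by (simp add: QtPt)
  qed
  have "G * ?D = ?Pt * ((M * A) * P)"
  proof -
    have "A * P = P * ?D * (Q * P)" using W by (simp add: as)
    also have "\<dots> = P * ?D" using W by (simp add: as)
    finally show ?thesis using W M unfolding G_def by (simp add: as)
  qed
  moreover have "transpose_mat (?Pt * ((M * A) * P)) = ?Pt * ((M * A) * P)"
  proof -
    have MA: "M * A \<in> carrier_mat n n" using M A by simp
    show ?thesis
      using W(6) MA transpose_mult[OF MA W(6)] MA_sym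
        transpose_mult[of "transpose_mat P" n n "(M * A) * P" n]
        as(1)[of "transpose_mat P" "M * A" P]
      by (simp add: mult_carrier_mat[of _ n n _ n])
  qed
  ultimately have "transpose_mat (G * ?D) = G * ?D" by simp
  hence GD: "?D * G = G * ?D"
    using G W by (simp add: transpose_mult[of _ n n _ n] Gt tD)
  have GE: "?E * G = G * ?E"
    by (rule mat_diag_intertwine[OF G GD])
  have "M * (P * ?E * Q) = ?Qt * G * ?E * Q"
    unfolding PG using W M by (simp add: as)
  also have "\<dots> = ?Qt * (?E * G) * Q"
    unfolding GE using W M G by (simp add: as)
  finally have e: "M * (P * ?E * Q) = ?Qt * (?E * G) * Q" .
  have "transpose_mat (?Qt * (?E * G) * Q) = ?Qt * (G * ?E) * Q"
    using W G by (simp add: transpose_mult[of _ n n _ n] as Gt tD)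
  thus ?thesis unfolding e GE .
qed

text \<open>Half of the power is moved to the other side: \<open>A\<^sup>s\<close> is the square of the self-adjoint \<open>A\<^bsup>s/2\<^esup>\<close>.\<close>

lemma mat_powr_form_nonneg:
  assumes MA_nonneg: "\<And>x. x \<in> carrier_vec n \<Longrightarrow> 0 \<le> scalar_prod x (M *\<^sub>v (A *\<^sub>v x))"
  shows "mat_powr A s \<in> carrier_mat n n"
    and "x \<in> carrier_vec n \<Longrightarrow> 0 \<le> scalar_prod x (M *\<^sub>v (mat_powr A s *\<^sub>v x))"
proof -
  obtain l P Q where w: "similar_mat_wit A (mat_diag n l) P Q"
    using diagonalizable by blast
  note W = similar_mat_witD2[OF A w]
  note as = assoc_mult_mat[of _ n n _ n _ n] mult_carrier_mat[of _ n n _ n] right_mult_one_mat[of _ n n]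
  have l: "\<forall>i<n. 0 \<le> l i"
    using eigenvalues_nonneg[OF w MA_nonneg] by blast
  have pw: "mat_powr A s = P * mat_diag n (\<lambda>i. l i powr s) * Q"
    by (rule mat_powr_eq[OF A w l])
  show "mat_powr A s \<in> carrier_mat n n" unfolding pw using W(4-) by (simp add: as)
  assume x: "x \<in> carrier_vec n"
  let ?E = "mat_diag n (\<lambda>i. l i powr (s / 2))"
  define B where "B = P * ?E * Q"
  have B: "B \<in> carrier_mat n n" unfolding B_def using W(4-) by (simp add: as)
  have "B * B = P * ?E * (Q * P) * ?E * Q"
    unfolding B_def using W(4-) by (simp add: as del: mat_diag_diag)
  also have "\<dots> = P * (?E * ?E) * Q"
    using W(2,4-) by (simp add: as del: mat_diag_diag)
  also have "\<dots> = mat_powr A s"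
    unfolding pw by (simp flip: powr_add)
  finally have BB: "mat_powr A s = B * B" by simp
  have MB: "M * B \<in> carrier_mat n n" and MBs: "transpose_mat (M * B) = M * B"
    using diag_fun_symmetric[OF w, of "\<lambda>t. t powr (s / 2)"] M B unfolding B_def by auto
  have Bx: "B *\<^sub>v x \<in> carrier_vec n" using B x by simp
  have "scalar_prod x (M *\<^sub>v (mat_powr A s *\<^sub>v x)) = scalar_prod x ((M * B) *\<^sub>v (B *\<^sub>v x))"
    unfolding BB using M B x Bx by simp
  also have "\<dots> = scalar_prod (B *\<^sub>v x) ((M * B) *\<^sub>v x)"
    by (rule sym_swap[OF MB MBs x Bx])
  also have "\<dots> = scalar_prod (B *\<^sub>v x) (M *\<^sub>v (B *\<^sub>v x))"
    using M B x by simp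
  also have "\<dots> \<ge> 0" by (rule M_nonneg[OF Bx])
  finally show "0 \<le> scalar_prod x (M *\<^sub>v (mat_powr A s *\<^sub>v x))" .
qed

end

section \<open>Square integrable functions\<close>

text \<open>The product is dominated by the sum of the squares.\<close>

lemma integrable_mult_L2:
  assumes "f \<in> L2_space \<Omega>" "g \<in> L2_space \<Omega>"
  shows "integrable (lebesgue_on \<Omega>) (\<lambda>x. f x * g x)"
proof (rule Bochner_Integration.integrable_bound)
  show "integrable (lebesgue_on \<Omega>) (\<lambda>x. (f x)\<^sup>2 + (g x)\<^sup>2)"
    using assms by (auto simp: L2_space_def)
  show "(\<lambda>x. f x * g x) \<in> borel_measurable (lebesgue_on \<Omega>)"
    using assms by (auto simp: L2_space_def)
  have "\<bar>f x * g x\<bar> \<le> (f x)\<^sup>2 + (g x)\<^sup>2" for x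
  proof -
    have "2 * (\<bar>f x\<bar> * \<bar>g x\<bar>) \<le> (f x)\<^sup>2 + (g x)\<^sup>2"
      using sum_squares_bound[of "\<bar>f x\<bar>" "\<bar>g x\<bar>"] by (simp add: mult.assoc)
    moreover have "0 \<le> \<bar>f x\<bar> * \<bar>g x\<bar>" by simp
    ultimately show ?thesis unfolding abs_mult by linarith
  qed
  thus "AE x in lebesgue_on \<Omega>. norm (f x * g x) \<le> norm ((f x)\<^sup>2 + (g x)\<^sup>2)"
    by (intro AE_I2) (simp add: order_trans)
qed

lemma L2_space_zero: "(\<lambda>_. 0) \<in> L2_space \<Omega>"
  by (simp add: L2_space_def)

lemma L2_space_add:
  assumes "f \<in> L2_space \<Omega>" "g \<in> L2_space \<Omega>"
  shows "(\<lambda>x. f x + g x) \<in> L2_space \<Omega>"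
  using assms integrable_mult_L2[OF assms]
  by (auto simp: L2_space_def power2_sum mult.assoc)

lemma L2_space_scale:
  assumes "f \<in> L2_space \<Omega>"
  shows "(\<lambda>x. c * f x) \<in> L2_space \<Omega>"
  using assms by (auto simp: L2_space_def power_mult_distrib)

lemma L2_space_lin_comb:
  assumes "finite I" "\<And>i. i \<in> I \<Longrightarrow> F i \<in> L2_space \<Omega>"
  shows "(\<lambda>x. \<Sum>i\<in>I. c i * F i x) \<in> L2_space \<Omega>"
  using assms
proof (induct rule: finite_induct)
  case (insert i I)
  have "(\<lambda>x. c i * F i x + (\<Sum>i\<in>I. c i * F i x)) \<in> L2_space \<Omega>"
    by (intro L2_space_add L2_space_scale) (use insert in auto)
  with insert show ?case by simp
qed (simp add: L2_space_zero)

lemma L2_inner_commute: "L2_inner \<Omega> f g = L2_inner \<Omega> g f"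
  by (simp add: L2_inner_def mult.commute)

lemma L2_inner_lin_comb_left:
  assumes "finite I" "\<And>i. i \<in> I \<Longrightarrow> F i \<in> L2_space \<Omega>" "g \<in> L2_space \<Omega>"
  shows "L2_inner \<Omega> (\<lambda>x. \<Sum>i\<in>I. c i * F i x) g = (\<Sum>i\<in>I. c i * L2_inner \<Omega> (F i) g)"
proof -
  have "L2_inner \<Omega> (\<lambda>x. \<Sum>i\<in>I. c i * F i x) g
      = (LINT x|lebesgue_on \<Omega>. (\<Sum>i\<in>I. c i * (F i x * g x)))"
    by (simp add: L2_inner_def sum_distrib_right mult.assoc)
  also have "\<dots> = (\<Sum>i\<in>I. LINT x|lebesgue_on \<Omega>. c i * (F i x * g x))"
    using assms by (intro Bochner_Integration.integral_sum)
      (auto intro!: integrable_mult_right integrable_mult_L2)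
  finally show ?thesis by (simp add: L2_inner_def)
qed

lemma L2_inner_self_nonneg: "0 \<le> L2_inner \<Omega> f f"
  by (simp add: L2_inner_def)

lemma L2_norm_nonneg: "0 \<le> L2_norm \<Omega> f"
  by (simp add: L2_norm_def L2_inner_self_nonneg)

lemma L2_norm_square: "L2_norm \<Omega> f * L2_norm \<Omega> f = L2_inner \<Omega> f f"
  by (simp add: L2_norm_def L2_inner_self_nonneg)

text \<open>The quadratic form \<open>\<parallel>s f - r g\<parallel>\<^sup>2\<close> in \<open>s\<close> and \<open>r\<close> is nonnegative. The choice \<open>s = \<parallel>g\<parallel>\<^sup>2\<close>,
\<open>r = (f, g)\<close> gives the inequality unless \<open>g\<close> has norm zero.\<close>

lemma L2_Cauchy_Schwarz:
  assumes f: "f \<in> L2_space \<Omega>" and g: "g \<in> L2_space \<Omega>"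
  shows "L2_inner \<Omega> f g \<le> L2_norm \<Omega> f * L2_norm \<Omega> g"
proof -
  let ?f = "L2_inner \<Omega> f f" and ?g = "L2_inner \<Omega> g g" and ?m = "L2_inner \<Omega> f g"
  have quad: "0 \<le> s * s * ?f - 2 * s * r * ?m + r * r * ?g" for s r
  proof -
    have "0 \<le> (LINT x|lebesgue_on \<Omega>. (s * f x - r * g x)\<^sup>2)" by simp
    also have "(\<lambda>x. (s * f x - r * g x)\<^sup>2)
        = (\<lambda>x. s * s * (f x * f x) - 2 * s * r * (f x * g x) + r * r * (g x * g x))"
      by (auto simp: fun_eq_iff power2_eq_square algebra_simps)
    also have "(LINT x|lebesgue_on \<Omega>. \<dots> x) = s * s * ?f - 2 * s * r * ?m + r * r * ?g"
      using integrable_mult_L2[OF f f] integrable_mult_L2[OF f g] integrable_mult_L2[OF g g]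
      by (simp add: L2_inner_def)
    finally show ?thesis .
  qed
  have "?m * ?m \<le> ?f * ?g"
  proof (cases "?g = 0")
    case True
    have "?m = 0"
    proof (rule ccontr)
      assume "?m \<noteq> 0"
      \<comment> \<open>For \<open>g\<close> of norm zero the quadratic form is affine in \<open>r\<close>; this \<open>r\<close> makes it equal to \<open>-1\<close>.\<close>
      thus False using quad[of 1 "(?f + 1) / (2 * ?m)"] True by simp
    qed
    thus ?thesis using True by simp
  next
    case False
    have "0 \<le> ?g * (?f * ?g - ?m * ?m)"
      using quad[of ?g ?m] by (simp add: algebra_simps)
    thus ?thesis using False L2_inner_self_nonneg[of \<Omega> g] by (simp add: zero_le_mult_iff)
  qed
  moreover have "(L2_norm \<Omega> f * L2_norm \<Omega> g)\<^sup>2 = ?f * ?g"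
    by (simp add: L2_norm_def power_mult_distrib L2_inner_self_nonneg)
  ultimately have "?m\<^sup>2 \<le> (L2_norm \<Omega> f * L2_norm \<Omega> g)\<^sup>2"
    by (simp add: power2_eq_square[of ?m])
  thus ?thesis by (rule power2_le_imp_le) (simp add: L2_norm_nonneg)
qed

lemma L2_space_bounded:
  assumes \<Omega>: "\<Omega> \<in> lmeasurable" and f: "f \<in> borel_measurable (lebesgue_on \<Omega>)"
    and B: "\<And>x. \<bar>f x\<bar> \<le> B"
  shows "f \<in> L2_space \<Omega>"
proof -
  interpret finite_measure "lebesgue_on \<Omega>" by (rule finite_measure_lebesgue_on[OF \<Omega>])
  have "(f x)\<^sup>2 \<le> B\<^sup>2" for x
    using power_mono[OF B[of x], of 2] by simp
  hence "integrable (lebesgue_on \<Omega>) (\<lambda>x. (f x)\<^sup>2)"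
    using f by (intro integrable_const_bound[of _ "B\<^sup>2"]) auto
  thus ?thesis using f by (simp add: L2_space_def)
qed

text \<open>Lebesgue measure is complete, so a function that agrees with a measurable one off a null set is
measurable whatever its values there. Needed for the partial derivatives, which take arbitrary
values where the function is not differentiable.\<close>

lemma L2_space_spike:
  assumes g: "g \<in> L2_space \<Omega>" and \<Omega>: "\<Omega> \<in> sets lebesgue" and N: "negligible N"
    and eq: "\<And>x. x \<in> \<Omega> - N \<Longrightarrow> f x = g x"
  shows "f \<in> L2_space \<Omega>"
proof -
  have "N \<inter> \<Omega> \<in> null_sets lebesgue"
    using N negligible_Int negligible_iff_null_sets by blast
  hence N': "N \<inter> \<Omega> \<in> null_sets (lebesgue_on \<Omega>)"
    using \<Omega> by (simp add: null_sets_restrict_space)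
  have "g \<in> borel_measurable (lebesgue_on (\<Omega> - N \<inter> \<Omega>))"
    using g borel_measurable_diff_null[OF N' \<Omega>] by (auto simp: L2_space_def)
  hence "f \<in> borel_measurable (lebesgue_on (\<Omega> - N \<inter> \<Omega>))"
    by (rule measurable_cong[THEN iffD1, rotated]) (use eq in auto)
  hence f: "f \<in> borel_measurable (lebesgue_on \<Omega>)"
    using borel_measurable_diff_null[OF N' \<Omega>] by auto
  have "AE x in lebesgue_on \<Omega>. (f x)\<^sup>2 = (g x)\<^sup>2"
    by (rule AE_I'[OF N']) (auto, metis DiffI eq)
  with f g have "integrable (lebesgue_on \<Omega>) (\<lambda>x. (f x)\<^sup>2)"
    by (subst integrable_cong_AE[of _ _ "\<lambda>x. (g x)\<^sup>2"]) (auto simp: L2_space_def)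
  with f show ?thesis by (simp add: L2_space_def)
qed

section \<open>Integrability of finite element functions\<close>

lemma bounded_prod_fun:
  fixes F :: "'i \<Rightarrow> 'a \<Rightarrow> real"
  assumes "\<And>i. i \<in> I \<Longrightarrow> \<exists>B. \<forall>x. \<bar>F i x\<bar> \<le> B"
  shows "\<exists>B. \<forall>x. \<bar>\<Prod>i\<in>I. F i x\<bar> \<le> B"
proof -
  obtain B where "\<And>i. i \<in> I \<Longrightarrow> \<forall>x. \<bar>F i x\<bar> \<le> B i"
    using assms by metis
  hence "\<bar>\<Prod>i\<in>I. F i x\<bar> \<le> (\<Prod>i\<in>I. B i)" for x
    unfolding abs_prod by (intro prod_mono) auto
  thus ?thesis by blast
qed

lemma bounded_sum_fun:
  fixes F :: "'i \<Rightarrow> 'a \<Rightarrow> real"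
  assumes "\<And>i. i \<in> I \<Longrightarrow> \<exists>B. \<forall>x. \<bar>F i x\<bar> \<le> B"
  shows "\<exists>B. \<forall>x. \<bar>\<Sum>i\<in>I. F i x\<bar> \<le> B"
proof -
  obtain B where "\<And>i. i \<in> I \<Longrightarrow> \<forall>x. \<bar>F i x\<bar> \<le> B i"
    using assms by metis
  hence "\<bar>\<Sum>i\<in>I. F i x\<bar> \<le> (\<Sum>i\<in>I. B i)" for x
    by (intro order_trans[OF sum_abs] sum_mono) auto
  thus ?thesis by blast
qed

lemma fe_space_1d_bounded:
  assumes "v \<in> fe_space_1d r m a b"
  shows "\<exists>B. \<forall>x. \<bar>v x\<bar> \<le> B"
proof -
  have "continuous_on {a..b} v" and 0: "\<And>x. x \<notin> {a<..<b} \<Longrightarrow> v x = 0"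
    using assms by (auto simp: fe_space_1d_def intro: continuous_on_subset)
  hence "bounded (v ` {a..b})"
    by (intro compact_imp_bounded compact_continuous_image) auto
  then obtain B where B: "0 < B" "\<And>x. x \<in> {a..b} \<Longrightarrow> \<bar>v x\<bar> \<le> B"
    by (auto simp: bounded_pos)
  have "\<bar>v x\<bar> \<le> B" for x
    using B 0[of x] by (cases "x \<in> {a..b}") auto
  thus ?thesis by blast
qed

text \<open>Inside each cell the function is a polynomial. The function \<open>g\<close> glues the derivatives of these
polynomials, and \<open>X\<close> consists of the mesh points.\<close>

lemma fe_space_1d_deriv:
  assumes v: "v \<in> fe_space_1d r m a b" and ab: "a < b" and m: "1 \<le> m"
  shows "\<exists>g X. finite X \<and> g \<in> borel_measurable borel \<and> (\<exists>B. \<forall>x. \<bar>g x\<bar> \<le> B) \<and>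
    (\<forall>x\<in>{a<..<b} - X. (v has_real_derivative g x) (at x))"
proof -
  define h where "h = (b - a) / real m"
  define p where "p i = a + real i * h" for i :: nat
  have h: "0 < h" using ab m by (simp add: h_def)
  have "\<forall>i<m. \<exists>q. \<forall>x\<in>{p i..p (Suc i)}. v x = poly q x"
    using v unfolding fe_space_1d_def p_def h_def by blast
  then obtain q where q: "\<And>i x. i < m \<Longrightarrow> x \<in> {p i..p (Suc i)} \<Longrightarrow> v x = poly (q i) x"
    by metis
  define g where "g x = (\<Sum>i<m. indicator {p i<..<p (Suc i)} x * poly (pderiv (q i)) x)" for x
  have "g \<in> borel_measurable borel"
    unfolding g_def
    by (intro borel_measurable_sum borel_measurable_times borel_measurable_indicator
        borel_measurable_continuous_onI continuous_intros) auto
  moreover have "\<exists>B. \<forall>x. \<bar>g x\<bar> \<le> B"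
    unfolding g_def
  proof (rule bounded_sum_fun)
    fix i
    have "bounded (poly (pderiv (q i)) ` {p i..p (Suc i)})"
      by (intro compact_imp_bounded compact_continuous_image continuous_intros) auto
    then obtain B where "0 < B" "\<And>x. x \<in> {p i..p (Suc i)} \<Longrightarrow> \<bar>poly (pderiv (q i)) x\<bar> \<le> B"
      by (auto simp: bounded_pos)
    hence "\<bar>indicator {p i<..<p (Suc i)} x * poly (pderiv (q i)) x\<bar> \<le> B" for x
      by (auto simp: indicator_def)
    thus "\<exists>B. \<forall>x. \<bar>indicator {p i<..<p (Suc i)} x * poly (pderiv (q i)) x\<bar> \<le> B" by blast
  qed
  moreover have "(v has_real_derivative g x) (at x)" if x: "x \<in> {a<..<b} - p ` {..m}" for x
  proof -
    define i where "i = nat \<lfloor>(x - a) / h\<rfloor>"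
    have pos: "0 \<le> (x - a) / h" using x h by auto
    have i1: "real i \<le> (x - a) / h" and i2: "(x - a) / h < real i + 1"
      unfolding i_def using pos by linarith+
    have "(x - a) / h < real m"
      using x h m by (auto simp: h_def field_simps)
    hence im: "i < m" using i1 by linarith
    have "p i \<le> x" "x < p (Suc i)"
      using i1 i2 h by (simp_all add: p_def field_simps)
    moreover have "p i \<noteq> x" using x im by auto
    ultimately have xi: "p i < x" "x < p (Suc i)" by auto
    have other: "x \<notin> {p j<..<p (Suc j)}" if "j \<noteq> i" for j
    proof
      assume "x \<in> {p j<..<p (Suc j)}"
      hence "p j < p (Suc i)" "p i < p (Suc j)" using xi by auto
      hence "real j < real (Suc i)" "real i < real (Suc j)"
        using h by (auto simp only: p_def add_less_cancel_left mult_less_cancel_right_pos)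
      with that show False by simp
    qed
    have "g x = poly (pderiv (q i)) x + (\<Sum>j\<in>{..<m} - {i}. 0)"
      unfolding g_def using im xi other
      by (subst sum.remove[of _ i]) (auto intro!: sum.cong)
    moreover have "(v has_real_derivative poly (pderiv (q i)) x) (at x)"
      by (rule has_field_derivative_transform_within_open
          [OF poly_DERIV open_greaterThanLessThan[of "p i" "p (Suc i)"]])
        (use xi im q in auto)
    ultimately show ?thesis by simp
  qed
  ultimately show ?thesis by blast
qed

context
  fixes a b :: "real^'d::finite"
begin

lemma fe_space_continuous:
  assumes "v \<in> fe_space r m a b"
  shows "continuous_on UNIV v"
proof -
  obtain J :: nat and \<phi> where \<phi>: "\<And>j k. j < J \<Longrightarrow> \<phi> j k \<in> fe_space_1d r (m k) (a $ k) (b $ k)"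
    and v: "v = (\<lambda>x. \<Sum>j<J. \<Prod>k\<in>UNIV. \<phi> j k (x $ k))"
    using assms unfolding fe_space_def by blast
  have "continuous_on UNIV (\<lambda>x. \<phi> j k (x $ k))" if "j < J" for j k
  proof (rule continuous_on_compose2[of UNIV "\<phi> j k"])
    show "continuous_on UNIV (\<phi> j k)" using \<phi>[OF that] by (simp add: fe_space_1d_def)
  qed (auto intro!: continuous_intros)
  thus ?thesis unfolding v by (intro continuous_on_sum continuous_on_prod) simp
qed

lemma fe_space_bounded:
  assumes "v \<in> fe_space r m a b"
  shows "\<exists>B. \<forall>x. \<bar>v x\<bar> \<le> B"
proof -
  obtain J :: nat and \<phi> where \<phi>: "\<And>j k. j < J \<Longrightarrow> \<phi> j k \<in> fe_space_1d r (m k) (a $ k) (b $ k)"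
    and v: "v = (\<lambda>x. \<Sum>j<J. \<Prod>k\<in>UNIV. \<phi> j k (x $ k))"
    using assms unfolding fe_space_def by blast
  have "\<exists>B. \<forall>x :: real^'d. \<bar>\<phi> j k (x $ k)\<bar> \<le> B" if j: "j < J" for j k
  proof -
    obtain B where "\<forall>y. \<bar>\<phi> j k y\<bar> \<le> B"
      using fe_space_1d_bounded[OF \<phi>[OF j, of k]] by (elim exE)
    thus ?thesis by (intro exI[of _ B]) simp
  qed
  note fac = this
  have prd: "\<exists>B. \<forall>x :: real^'d. \<bar>\<Prod>k\<in>UNIV. \<phi> j k (x $ k)\<bar> \<le> B" if "j < J" for j
    by (rule bounded_prod_fun) (rule fac[OF that])
  show ?thesis unfolding v
  proof (rule bounded_sum_fun)
    fix j assume "j \<in> {..<J}"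
    thus "\<exists>B. \<forall>x :: real^'d. \<bar>\<Prod>k\<in>UNIV. \<phi> j k (x $ k)\<bar> \<le> B" by (intro prd) simp
  qed
qed

lemma fe_space_zero_outside:
  assumes "v \<in> fe_space r m a b" and x: "x \<notin> box a b"
  shows "v x = 0"
proof -
  obtain J :: nat and \<phi> where \<phi>: "\<And>j k. j < J \<Longrightarrow> \<phi> j k \<in> fe_space_1d r (m k) (a $ k) (b $ k)"
    and v: "v = (\<lambda>x. \<Sum>j<J. \<Prod>k\<in>UNIV. \<phi> j k (x $ k))"
    using assms unfolding fe_space_def by blast
  obtain k where k: "x $ k \<notin> {a $ k<..<b $ k}"
    using x by (auto simp: mem_box_cart)
  have "(\<Prod>k\<in>UNIV. \<phi> j k (x $ k)) = 0" if "j < J" for j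
  proof -
    have "\<phi> j k (x $ k) = 0" using \<phi>[OF that, of k] k unfolding fe_space_1d_def by blast
    thus ?thesis by (intro prod_zero) auto
  qed
  thus ?thesis unfolding v by (intro sum.neutral) simp
qed

lemma fe_space_L2:
  assumes "v \<in> fe_space r m a b"
  shows "v \<in> L2_space (box a b)"
proof -
  obtain B where "\<And>x. \<bar>v x\<bar> \<le> B" using fe_space_bounded[OF assms] by blast
  moreover have "v \<in> borel_measurable (lebesgue_on (box a b))"
    using fe_space_continuous[OF assms]
    by (intro continuous_imp_measurable_on_sets_lebesgue) (auto intro: continuous_on_subset)
  ultimately show ?thesis by (intro L2_space_bounded) auto
qed

text \<open>The set where \<open>v\<close> is nonzero is open, by continuity, and null; hence it is empty.\<close>

lemma fe_space_definite:
  assumes v: "v \<in> fe_space r m a b" and 0: "L2_inner (box a b) v v = 0"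
  shows "v = (\<lambda>_. 0)"
proof
  fix x
  let ?U = "{x \<in> box a b. v x \<noteq> 0}"
  have U: "open ?U"
  proof -
    have "open (v -` (- {0}))"
      using fe_space_continuous[OF v] by (intro open_vimage) auto
    moreover have "?U = box a b \<inter> v -` (- {0})" by auto
    ultimately show ?thesis by (auto intro: open_Int)
  qed
  have "AE x in lebesgue_on (box a b). v x * v x = 0"
    using 0 integrable_mult_L2[OF fe_space_L2[OF v] fe_space_L2[OF v]]
    by (subst (asm) L2_inner_def, subst (asm) integral_nonneg_eq_0_iff_AE) auto
  hence "AE x in lebesgue. x \<in> box a b \<longrightarrow> v x * v x = 0"
    by (simp add: AE_restrict_space_iff)
  hence "?U \<in> null_sets lebesgue"
    using U by (subst (asm) AE_iff_null) (auto intro: lebesgue_openin)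
  hence "negligible ?U" by (simp add: negligible_iff_null_sets)
  hence "?U = {}" using U open_not_negligible by blast
  thus "v x = 0" using fe_space_zero_outside[OF v, of x] by auto
qed

text \<open>Differentiating the product structure in direction \<open>k\<close> replaces the factor in that direction by its
derivative. This is legitimate off the finitely many hyperplanes through the mesh points, and the
resulting function is bounded and Borel measurable.\<close>

lemma fe_space_partial_deriv_L2:
  assumes v: "v \<in> fe_space r m a b" and ab: "\<forall>k. a $ k < b $ k" and m: "\<forall>k. 1 \<le> m k"
  shows "partial_deriv k v \<in> L2_space (box a b)"
proof -
  obtain J :: nat and \<phi> where \<phi>: "\<And>j k. j < J \<Longrightarrow> \<phi> j k \<in> fe_space_1d r (m k) (a $ k) (b $ k)"
    and veq: "v = (\<lambda>x. \<Sum>j<J. \<Prod>k\<in>UNIV. \<phi> j k (x $ k))"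
    using v unfolding fe_space_def by blast
  have "\<forall>j. j < J \<longrightarrow> (\<exists>g X. finite X \<and> g \<in> borel_measurable borel \<and> (\<exists>B. \<forall>x. \<bar>g x\<bar> \<le> B) \<and>
    (\<forall>x\<in>{a $ k<..<b $ k} - X. (\<phi> j k has_real_derivative g x) (at x)))"
    using fe_space_1d_deriv[OF \<phi>] ab m by blast
  then obtain g X where X: "\<And>j. j < J \<Longrightarrow> finite (X j)"
    and g: "\<And>j. j < J \<Longrightarrow> g j \<in> borel_measurable borel"
      "\<And>j. j < J \<Longrightarrow> \<exists>B. \<forall>x. \<bar>g j x\<bar> \<le> B"
      "\<And>j x. j < J \<Longrightarrow> x \<in> {a $ k<..<b $ k} - X j \<Longrightarrow> (\<phi> j k has_real_derivative g j x) (at x)"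
    by metis
  define G where "G x = (\<Sum>j<J. g j (x $ k) * (\<Prod>l\<in>UNIV - {k}. \<phi> j l (x $ l)))" for x :: "real^'d"
  define N where "N = (\<Union>j<J. \<Union>c\<in>X j. {x :: real^'d. x $ k = c})"
  have N: "negligible N"
  proof -
    have "negligible {x :: real^'d. x $ k = c}" for c
      using negligible_standard_hyperplane[of "axis k 1 :: real^'d" c]
      by (simp add: inner_axis axis_in_Basis_iff)
    hence "{x :: real^'d. x $ k = c} \<in> null_sets lebesgue" for c
      by (simp add: negligible_iff_null_sets)
    hence "N \<in> null_sets lebesgue"
      unfolding N_def using X by (intro null_sets_UN' countable_finite) auto
    thus ?thesis by (simp add: negligible_iff_null_sets)
  qed
  have comp: "(\<lambda>x :: real^'d. f (x $ l)) \<in> borel_measurable borel"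
    if "f \<in> borel_measurable borel" for f :: "real \<Rightarrow> real" and l
  proof (rule measurable_compose[OF _ that])
    show "(\<lambda>x :: real^'d. x $ l) \<in> borel_measurable borel"
      by (intro borel_measurable_continuous_onI continuous_intros)
  qed
  have \<phi>m: "\<phi> j l \<in> borel_measurable borel" if "j < J" for j l
    using \<phi>[OF that, of l] by (intro borel_measurable_continuous_onI) (simp add: fe_space_1d_def)
  have "G \<in> borel_measurable borel"
    unfolding G_def
  proof (intro borel_measurable_sum borel_measurable_times borel_measurable_prod)
    fix j assume "j \<in> {..<J}"
    hence j: "j < J" by simp
    show "(\<lambda>x :: real^'d. g j (x $ k)) \<in> borel_measurable borel" by (rule comp[OF g(1)[OF j]])
    show "(\<lambda>x :: real^'d. \<phi> j l (x $ l)) \<in> borel_measurable borel" for l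
      by (rule comp[OF \<phi>m[OF j]])
  qed
  hence Gm: "G \<in> borel_measurable (lebesgue_on (box a b))"
    by (intro measurable_restrict_space1 measurable_completion) simp
  have "\<exists>B. \<forall>x. \<bar>G x\<bar> \<le> B"
    unfolding G_def
  proof (rule bounded_sum_fun)
    fix j assume "j \<in> {..<J}"
    hence j: "j < J" by simp
    obtain B where B: "\<And>x. \<bar>g j x\<bar> \<le> B" using g(2)[OF j] by blast
    have "\<exists>C. \<forall>x. \<bar>\<Prod>l\<in>UNIV - {k}. \<phi> j l (x $ l)\<bar> \<le> C"
    proof (rule bounded_prod_fun)
      fix l
      obtain C where "\<forall>y. \<bar>\<phi> j l y\<bar> \<le> C"
        using fe_space_1d_bounded[OF \<phi>[OF j, of l]] by (elim exE)
      thus "\<exists>C. \<forall>x :: real^'d. \<bar>\<phi> j l (x $ l)\<bar> \<le> C" by (intro exI[of _ C]) simp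
    qed
    then obtain C where C: "\<And>x. \<bar>\<Prod>l\<in>UNIV - {k}. \<phi> j l (x $ l)\<bar> \<le> C" by blast
    have "\<bar>g j (x $ k) * (\<Prod>l\<in>UNIV - {k}. \<phi> j l (x $ l))\<bar> \<le> B * C" for x
      unfolding abs_mult using order_trans[OF abs_ge_zero B] by (intro mult_mono B C) auto
    thus "\<exists>B. \<forall>x. \<bar>g j (x $ k) * (\<Prod>l\<in>UNIV - {k}. \<phi> j l (x $ l))\<bar> \<le> B" by blast
  qed
  then obtain B where B: "\<bar>G x\<bar> \<le> B" for x by blast
  have G2: "G \<in> L2_space (box a b)"
    by (rule L2_space_bounded[OF lmeasurable_box Gm B])
  have eq: "partial_deriv k v x = G x" if x: "x \<in> box a b - N" for x
  proof -
    have "((\<lambda>h. \<phi> j k (h + x $ k)) has_real_derivative g j (x $ k)) (at 0)" if j: "j < J" for j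
    proof -
      have "x $ k \<in> {a $ k<..<b $ k} - X j"
        using x j unfolding N_def by (auto simp: mem_box_cart)
      from g(3)[OF j this] show ?thesis
        using DERIV_shift[of "\<phi> j k" "g j (x $ k)" 0 "x $ k"] by simp
    qed
    hence "((\<lambda>h. \<Sum>j<J. \<phi> j k (h + x $ k) * (\<Prod>l\<in>UNIV - {k}. \<phi> j l (x $ l)))
        has_real_derivative G x) (at 0)"
      unfolding G_def by (intro DERIV_sum DERIV_cmult_right) auto
    moreover have "(\<lambda>h. v (x + h *\<^sub>R axis k 1))
        = (\<lambda>h. \<Sum>j<J. \<phi> j k (h + x $ k) * (\<Prod>l\<in>UNIV - {k}. \<phi> j l (x $ l)))"
      unfolding veq
      by (intro ext sum.cong refl, subst prod.remove[of _ k])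
        (auto simp: axis_def add.commute intro!: prod.cong)
    ultimately show ?thesis unfolding partial_deriv_def by (simp add: DERIV_imp_deriv)
  qed
  show ?thesis by (rule L2_space_spike[OF G2 _ N eq]) auto
qed

end

section \<open>Positivity of the discrete fractional operator\<close>

lemma L2_inner_gram:
  fixes n :: nat
  assumes "\<And>i. i < n \<Longrightarrow> F i \<in> L2_space \<Omega>"
  shows "L2_inner \<Omega> (\<lambda>p. \<Sum>i<n. x i * F i p) (\<lambda>p. \<Sum>j<n. y j * F j p)
    = (\<Sum>i<n. \<Sum>j<n. x i * y j * L2_inner \<Omega> (F j) (F i))"
proof -
  have "L2_inner \<Omega> (\<lambda>p. \<Sum>i<n. x i * F i p) (\<lambda>p. \<Sum>j<n. y j * F j p)
      = (\<Sum>i<n. x i * L2_inner \<Omega> (F i) (\<lambda>p. \<Sum>j<n. y j * F j p))"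
    using assms by (intro L2_inner_lin_comb_left L2_space_lin_comb) auto
  also have "\<dots> = (\<Sum>i<n. x i * (\<Sum>j<n. y j * L2_inner \<Omega> (F j) (F i)))"
    using assms by (intro sum.cong refl, subst L2_inner_commute, subst L2_inner_lin_comb_left) auto
  finally show ?thesis by (simp add: sum_distrib_left mult.assoc)
qed

lemma scalar_prod_mat_vec:
  assumes "B \<in> carrier_mat n n" "x \<in> carrier_vec n" "y \<in> carrier_vec n"
  shows "scalar_prod x (B *\<^sub>v y)
    = (\<Sum>i<n. \<Sum>j<n. vec_index x i * vec_index y j * (B $$ (i, j) :: real))"
  using assms
  by (auto simp: scalar_prod_def atLeast0LessThan sum_distrib_left mult_ac intro!: sum.cong)

locale fe_basis =
  fixes a b :: "real^'d::finite" and r :: nat and m :: "'d \<Rightarrow> nat"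
    and \<phi> :: "(real^'d \<Rightarrow> real) list"
  assumes ab: "\<forall>k. a $ k < b $ k" and m: "\<forall>k. 1 \<le> m k"
    and basis: "is_fun_basis \<phi> (fe_space r m a b)"
begin

abbreviation "V \<equiv> fe_space r m a b"
abbreviation "\<Omega> \<equiv> box a b"
abbreviation "n \<equiv> length \<phi>"
abbreviation "M \<equiv> mass_matrix \<Omega> \<phi>"
abbreviation "S \<equiv> stiffness_matrix \<Omega> \<phi>"

lemma lin_comb_mem: "x \<in> carrier_vec n \<Longrightarrow> lin_comb \<phi> x \<in> V"
  using basis unfolding is_fun_basis_def by (auto dest: bij_betwE)

lemma basis_mem:
  assumes "i < n"
  shows "\<phi> ! i \<in> V"
proof -
  have "lin_comb \<phi> (unit_vec n i) y = (\<Sum>j<n. if j = i then (\<phi> ! i) y else 0)" for y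
    unfolding lin_comb_def using assms by (intro sum.cong) auto
  hence "lin_comb \<phi> (unit_vec n i) = \<phi> ! i" using assms by (simp add: fun_eq_iff)
  thus ?thesis using lin_comb_mem[of "unit_vec n i"] by simp
qed

lemma coords:
  assumes "u \<in> V"
  shows "coords \<phi> u \<in> carrier_vec n" "lin_comb \<phi> (coords \<phi> u) = u"
  using assms basis unfolding is_fun_basis_def coords_def
  by (auto simp: bij_betw_def intro!: inv_into_into f_inv_into_f)

lemma mass_carrier: "M \<in> carrier_mat n n"
  by (simp add: mass_matrix_def)

lemma stiffness_carrier: "S \<in> carrier_mat n n"
  by (simp add: stiffness_matrix_def)

lemma mass_sym: "transpose_mat M = M"
  by (intro eq_matI) (auto simp: mass_matrix_def L2_inner_commute)

lemma stiffness_sym: "transpose_mat S = S"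
  by (intro eq_matI)
    (auto simp: stiffness_matrix_def intro!: sum.cong L2_inner_commute)

text \<open>The reason for the mass matrix: it represents the \<open>L\<^sup>2\<close> inner product in coordinates.\<close>

lemma mass_form:
  assumes "x \<in> carrier_vec n" "y \<in> carrier_vec n"
  shows "scalar_prod x (M *\<^sub>v y) = L2_inner \<Omega> (lin_comb \<phi> x) (lin_comb \<phi> y)"
  unfolding scalar_prod_mat_vec[OF mass_carrier assms] lin_comb_def
  by (subst L2_inner_gram) (auto simp: mass_matrix_def intro: fe_space_L2[OF basis_mem])

lemma mass_pos:
  assumes x: "x \<in> carrier_vec n" "x \<noteq> 0\<^sub>v n"
  shows "0 < scalar_prod x (M *\<^sub>v x)"
proof -
  have "lin_comb \<phi> (0\<^sub>v n) = (\<lambda>_. 0)"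
    by (simp add: lin_comb_def)
  moreover have "lin_comb \<phi> x \<noteq> lin_comb \<phi> (0\<^sub>v n)"
    using basis x inj_onD unfolding is_fun_basis_def bij_betw_def by fastforce
  ultimately have "L2_inner \<Omega> (lin_comb \<phi> x) (lin_comb \<phi> x) \<noteq> 0"
    using fe_space_definite[OF lin_comb_mem[OF x(1)]] by metis
  thus ?thesis unfolding mass_form[OF x(1) x(1)]
    using L2_inner_self_nonneg[of \<Omega> "lin_comb \<phi> x"] by simp
qed

text \<open>The form is the sum over the directions of the squared norms of \<open>\<Sum>\<^sub>i x\<^sub>i \<partial>\<^sub>k \<phi>\<^sub>i\<close>. Square
integrability of the derivatives is what makes these integrals bilinear.\<close>

lemma stiffness_nonneg:
  assumes x: "x \<in> carrier_vec n"
  shows "0 \<le> scalar_prod x (S *\<^sub>v x)"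
proof -
  let ?D = "\<lambda>k i. partial_deriv k (\<phi> ! i)"
  have D: "?D k i \<in> L2_space \<Omega>" if "i < n" for k i
    using fe_space_partial_deriv_L2[OF basis_mem[OF that] ab m] .
  have "scalar_prod x (S *\<^sub>v x)
      = (\<Sum>i<n. \<Sum>j<n. \<Sum>k\<in>UNIV. vec_index x i * vec_index x j * L2_inner \<Omega> (?D k j) (?D k i))"
    unfolding scalar_prod_mat_vec[OF stiffness_carrier x x]
    by (simp add: stiffness_matrix_def sum_distrib_left)
  also have "\<dots> = (\<Sum>i<n. \<Sum>k\<in>UNIV. \<Sum>j<n. vec_index x i * vec_index x j * L2_inner \<Omega> (?D k j) (?D k i))"
    by (intro sum.cong refl sum.swap)
  also have "\<dots> = (\<Sum>k\<in>UNIV. \<Sum>i<n. \<Sum>j<n. vec_index x i * vec_index x j * L2_inner \<Omega> (?D k j) (?D k i))"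
    by (rule sum.swap)
  also have "\<dots> = (\<Sum>k\<in>UNIV. L2_inner \<Omega> (\<lambda>p. \<Sum>i<n. vec_index x i * ?D k i p)
      (\<lambda>p. \<Sum>i<n. vec_index x i * ?D k i p))"
    using D by (intro sum.cong refl L2_inner_gram[symmetric])
  also have "\<dots> \<ge> 0" by (intro sum_nonneg L2_inner_self_nonneg)
  finally show ?thesis .
qed

lemma mass_inverse:
  "M * the (mat_inverse M) = 1\<^sub>m n" "the (mat_inverse M) \<in> carrier_mat n n"
proof -
  have "Determinant.det M \<noteq> 0"
  proof
    assume "Determinant.det M = 0"
    then obtain x where x: "x \<in> carrier_vec n" "x \<noteq> 0\<^sub>v n" "M *\<^sub>v x = 0\<^sub>v n"
      using det_0_iff_vec_prod_zero[OF mass_carrier] by blast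
    thus False using mass_pos[OF x(1,2)] by simp
  qed
  hence "M \<in> Units (ring_mat TYPE(real) n ())"
    by (rule det_non_zero_imp_unit[OF mass_carrier])
  hence "mat_inverse M \<noteq> None"
    using mat_inverse(1)[OF mass_carrier, where b = "()"] by blast
  thus "M * the (mat_inverse M) = 1\<^sub>m n" "the (mat_inverse M) \<in> carrier_mat n n"
    using mat_inverse(2)[OF mass_carrier] by auto
qed

context
  fixes \<gamma> :: real
  assumes \<gamma>: "0 \<le> \<gamma>"
begin

abbreviation "A \<equiv> the (mat_inverse M) * S + \<gamma> \<cdot>\<^sub>m 1\<^sub>m n"

lemma operator_carrier: "A \<in> carrier_mat n n"
  using mass_inverse stiffness_carrier by simp

lemma mass_operator: "M * A = S + \<gamma> \<cdot>\<^sub>m M"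
proof -
  note c = mass_carrier stiffness_carrier mass_inverse(2)
  have "M * A = M * (the (mat_inverse M) * S) + M * (\<gamma> \<cdot>\<^sub>m 1\<^sub>m n)"
    using c by (intro mult_add_distrib_mat) auto
  also have "M * (the (mat_inverse M) * S) = S"
    using c mass_inverse(1) by (simp flip: assoc_mult_mat[of _ n n _ n _ n])
  also have "M * (\<gamma> \<cdot>\<^sub>m 1\<^sub>m n) = \<gamma> \<cdot>\<^sub>m M"
    using c by (simp add: mult_smult_distrib[OF mass_carrier one_carrier_mat])
  finally show ?thesis .
qed

lemma operator_selfadjoint: "mass_selfadjoint n M A"
proof
  show "transpose_mat (M * A) = M * A"
  proof -
    have "transpose_mat (\<gamma> \<cdot>\<^sub>m M) = \<gamma> \<cdot>\<^sub>m transpose_mat M"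
      by (intro eq_matI) auto
    thus ?thesis unfolding mass_operator
      using mass_carrier stiffness_carrier
      by (simp add: transpose_add[of _ n n] mass_sym stiffness_sym)
  qed
qed (use mass_carrier operator_carrier mass_sym mass_pos in auto)

lemma operator_nonneg:
  assumes x: "x \<in> carrier_vec n"
  shows "0 \<le> scalar_prod x (M *\<^sub>v (A *\<^sub>v x))"
proof -
  interpret operator: mass_selfadjoint n M A by (rule operator_selfadjoint)
  have smult: "(\<gamma> \<cdot>\<^sub>m M) *\<^sub>v x = \<gamma> \<cdot>\<^sub>v (M *\<^sub>v x)"
    using mass_carrier x by (intro eq_vecI) auto
  have "M *\<^sub>v (A *\<^sub>v x) = (M * A) *\<^sub>v x"
    using assoc_mult_mat_vec[OF mass_carrier operator_carrier x] by simp
  also have "\<dots> = S *\<^sub>v x + \<gamma> \<cdot>\<^sub>v (M *\<^sub>v x)"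
    unfolding mass_operator using mass_carrier stiffness_carrier x
    by (simp add: add_mult_distrib_mat_vec[of _ n n] smult)
  finally have "scalar_prod x (M *\<^sub>v (A *\<^sub>v x))
      = scalar_prod x (S *\<^sub>v x) + \<gamma> * scalar_prod x (M *\<^sub>v x)"
    using mass_carrier stiffness_carrier x by (simp add: scalar_prod_add_distrib[of _ n])
  thus ?thesis using stiffness_nonneg[OF x] operator.M_nonneg[OF x] \<gamma> by simp
qed

lemma frac_form_nonneg:
  assumes u: "u \<in> V"
  shows "0 \<le> frac_form \<Omega> \<phi> \<gamma> s u u"
proof -
  interpret operator: mass_selfadjoint n M A by (rule operator_selfadjoint)
  let ?x = "coords \<phi> u"
  note x = coords[OF u]
  note pw = operator.mat_powr_form_nonneg[OF operator_nonneg, where s = s]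
  have c: "mat_powr A s *\<^sub>v ?x \<in> carrier_vec n"
    using pw(1) x(1) by simp
  have "frac_form \<Omega> \<phi> \<gamma> s u u
      = L2_inner \<Omega> (lin_comb \<phi> (mat_powr A s *\<^sub>v ?x)) (lin_comb \<phi> ?x)"
    unfolding frac_form_def frac_op_def x(2) ..
  also have "\<dots> = scalar_prod ?x (M *\<^sub>v (mat_powr A s *\<^sub>v ?x))"
    unfolding mass_form[OF x(1) c] by (rule L2_inner_commute)
  also have "\<dots> \<ge> 0" using pw(2) x(1) by simp
  finally show ?thesis .
qed

end
end

section \<open>The energy estimate\<close>

lemma sum_by_parts:
  fixes c g :: "nat \<Rightarrow> real"
  assumes "1 \<le> n"
  shows "(\<Sum>k=1..n. c k * (g k - g (k - 1)))
    = c n * g n - c 1 * g 0 - (\<Sum>k=1..n-1. (c (k + 1) - c k) * g k)"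
  using assms
proof (induct n rule: nat_induct_at_least)
  case (Suc n)
  have "(\<Sum>k=1..n. (c (k + 1) - c k) * g k)
      = (\<Sum>k=1..n-1. (c (k + 1) - c k) * g k) + (c (n + 1) - c n) * g n"
    using Suc(1) sum.cl_ivl_Suc[of _ 1 "n - 1"] by simp
  with Suc show ?case by (simp add: algebra_simps)
qed (simp add: algebra_simps)

text \<open>The number \<open>p\<close> stands for the dissipation of the spatial operator; only its sign matters.\<close>

lemma energy_estimate:
  fixes n :: nat and c :: "nat \<Rightarrow> real"
  assumes n: "1 \<le> n"
    and c1: "0 \<le> c 1" and c: "\<And>k. k \<in> {1..<n} \<Longrightarrow> c k \<le> c (k + 1)" and cn: "0 < c n"
    and u: "\<And>k. k \<le> n \<Longrightarrow> u k \<in> L2_space \<Omega>" and F: "F \<in> L2_space \<Omega>"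
    and p: "0 \<le> p"
    and eq: "L2_inner \<Omega> (\<lambda>x. \<Sum>k=1..n. c k * (u k x - u (k - 1) x)) (u n) + p
      = L2_inner \<Omega> F (u n)"
  shows "L2_norm \<Omega> (u n) \<le> 1 / c n * (L2_norm \<Omega> F + c 1 * L2_norm \<Omega> (u 0)
    + (\<Sum>k=1..n-1. (c (k + 1) - c k) * L2_norm \<Omega> (u k)))"
proof -
  let ?N = "\<lambda>v. L2_norm \<Omega> v" and ?I = "\<lambda>v. L2_inner \<Omega> v (u n)"
  let ?R = "?N F + c 1 * ?N (u 0) + (\<Sum>k=1..n-1. (c (k + 1) - c k) * ?N (u k))"
  have un: "u n \<in> L2_space \<Omega>" using u by simp
  have CS: "?I v \<le> ?N v * ?N (u n)" if "v \<in> L2_space \<Omega>" for v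
    by (rule L2_Cauchy_Schwarz[OF that un])
  have step: "c (k + 1) - c k \<ge> 0" if "k \<in> {1..n-1}" for k
    using c[of k] that n by auto
  have diff: "(\<lambda>x. u k x - u (k - 1) x) \<in> L2_space \<Omega>"
      "?I (\<lambda>x. u k x - u (k - 1) x) = ?I (u k) - ?I (u (k - 1))" if "k \<in> {1..n}" for k
  proof -
    have uk: "u k \<in> L2_space \<Omega>" "u (k - 1) \<in> L2_space \<Omega>" using that u by auto
    show "(\<lambda>x. u k x - u (k - 1) x) \<in> L2_space \<Omega>"
      using L2_space_add[OF uk(1) L2_space_scale[OF uk(2), of "-1"]] by simp
    show "?I (\<lambda>x. u k x - u (k - 1) x) = ?I (u k) - ?I (u (k - 1))"
      using integrable_mult_L2[OF uk(1) un] integrable_mult_L2[OF uk(2) un]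
      by (simp add: L2_inner_def left_diff_distrib)
  qed
  have "?I (\<lambda>x. \<Sum>k=1..n. c k * (u k x - u (k - 1) x))
      = (\<Sum>k=1..n. c k * ?I (\<lambda>x. u k x - u (k - 1) x))"
    using diff(1) un by (intro L2_inner_lin_comb_left) auto
  also have "\<dots> = (\<Sum>k=1..n. c k * (?I (u k) - ?I (u (k - 1))))"
    by (intro sum.cong refl) (simp only: diff(2))
  also have "\<dots> = c n * ?I (u n) - c 1 * ?I (u 0) - (\<Sum>k=1..n-1. (c (k + 1) - c k) * ?I (u k))"
    by (rule sum_by_parts[OF n])
  finally have "c n * (?N (u n) * ?N (u n))
      \<le> ?I F + c 1 * ?I (u 0) + (\<Sum>k=1..n-1. (c (k + 1) - c k) * ?I (u k))"
    using eq p by (simp add: L2_norm_square)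
  also have "\<dots> \<le> ?N F * ?N (u n) + c 1 * (?N (u 0) * ?N (u n))
      + (\<Sum>k=1..n-1. (c (k + 1) - c k) * (?N (u k) * ?N (u n)))"
    using c1 step u F by (intro add_mono sum_mono mult_left_mono CS) auto
  also have "\<dots> = ?R * ?N (u n)"
    by (simp add: algebra_simps sum_distrib_right sum_distrib_left)
  finally have main: "(c n * ?N (u n)) * ?N (u n) \<le> ?R * ?N (u n)" by (simp add: mult.assoc)
  have "c n * ?N (u n) \<le> ?R"
  proof (cases "?N (u n) = 0")
    case True
    have "0 \<le> ?R" using c1 step by (intro add_nonneg_nonneg sum_nonneg mult_nonneg_nonneg L2_norm_nonneg) auto
    thus ?thesis using True by simp
  next
    case False
    with main show ?thesis using L2_norm_nonneg[of \<Omega> "u n"] by simp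
  qed
  thus ?thesis using cn by (simp add: field_simps)
qed

lemma soe_hist_zero:
  "(\<And>k. k \<le> i \<Longrightarrow> \<rho> k = 0) \<Longrightarrow> soe_hist \<xi> t \<rho> i = 0"
  by (induct i) (auto simp: Let_def)

text \<open>Applying the formula to the grid function supported at \<open>n\<close> singles out its last coefficient: the
history variables up to \<open>n - 1\<close> vanish.\<close>

lemma cbar_diag:
  assumes n: "1 \<le> n"
    and coeff: "\<And>\<rho>. (\<Sum>k=0..n. \<beta> n k * \<rho> k) = fast_caputo \<alpha> t Q w \<xi> n \<rho>"
  shows "cbar \<beta> n n = 1 / step_tau \<alpha> t n"
proof -
  let ?\<rho> = "\<lambda>k. if k = n then 1 else 0 :: real"
  have "cbar \<beta> n n = \<beta> n n" using n by (cases n) auto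
  also have "\<dots> = (\<Sum>k=0..n. \<beta> n k * ?\<rho> k)" by (simp add: if_distrib[of "\<lambda>x. _ * x"] sum.delta cong: if_cong)
  also have "\<dots> = fast_caputo \<alpha> t Q w \<xi> n ?\<rho>" by (rule coeff)
  also have "\<dots> = 1 / step_tau \<alpha> t n"
    unfolding fast_caputo_def using n soe_hist_zero[of "n - 1" ?\<rho>] by auto
  finally show ?thesis .
qed

theorem theorem3p1:
  fixes \<alpha> s \<gamma> \<kappa> T \<omega> ymin ymax \<epsilon> C :: real
    and a b :: "real^'d::finite"
    and r N Q :: nat
    and m :: "'d \<Rightarrow> nat"
    and \<phi> :: "(real^'d \<Rightarrow> real) list"
    and \<beta> :: "nat \<Rightarrow> nat \<Rightarrow> real"
    and f :: "real^'d \<Rightarrow> real \<Rightarrow> real"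
    and u :: "nat \<Rightarrow> real^'d \<Rightarrow> real"
  defines "\<Omega> \<equiv> box a b"
    and "V \<equiv> fe_space r m a b"
    and "t \<equiv> graded_mesh T \<omega> N"
    and "w \<equiv> soe_weight \<alpha> ymin ymax Q"
    and "\<xi> \<equiv> soe_node ymin ymax Q"
    and "c \<equiv> cbar \<beta>"
  assumes "0 < \<alpha>" "\<alpha> < 1" "0 < s" "s < 1" "0 \<le> \<gamma>" "0 < \<kappa>" "0 < T"
    and "CARD('d) \<in> {1, 2, 3}" "\<forall>k. a $ k < b $ k"
    and "1 \<le> r" "\<forall>k. 1 \<le> m k"
    and basis: "is_fun_basis \<phi> V"
    and "1 \<le> \<omega>" "1 \<le> N"
    and "1 < Q" "ymin < ymax" "0 < \<epsilon>" "0 < C"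
    and soe: "\<forall>x\<in>{t 1..T}. \<bar>(\<Sum>j=1..Q. w j * exp (\<xi> j * x)) - x powr (-1 - \<alpha>) / Gamma (- \<alpha>)\<bar>
                \<le> C * \<epsilon> * x powr (-1 - \<alpha>)"
    and coeff: "\<forall>n\<in>{1..N}. \<forall>\<rho>. (\<Sum>k=0..n. \<beta> n k * \<rho> k) = fast_caputo \<alpha> t Q w \<xi> n \<rho>"
    and mono: "\<forall>n\<in>{1..N}. \<forall>k\<in>{1..<n}. c n k \<le> c n (k + 1)"
    and lower: "\<forall>n\<in>{1..N}. t n powr (- \<alpha>) / Gamma (1 - \<alpha>) \<le> c n 1"
    and "\<forall>n\<in>{1..N}. (\<lambda>x. f x (t n)) \<in> L2_space \<Omega>"
    and "\<forall>n\<in>{0..N}. u n \<in> V"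
    and scheme: "\<forall>n\<in>{1..N}. \<forall>v\<in>V.
          L2_inner \<Omega> (\<lambda>x. \<Sum>k=1..n. c n k * (u k x - u (k - 1) x)) v
            + \<kappa> * frac_form \<Omega> \<phi> \<gamma> s (u n) v
          = L2_inner \<Omega> (\<lambda>x. f x (t n)) v"
  shows "\<forall>n\<in>{1..N}.
      L2_norm \<Omega> (u n) \<le> 1 / c n n *
        (L2_norm \<Omega> (\<lambda>x. f x (t n)) + c n 1 * L2_norm \<Omega> (u 0)
          + (\<Sum>k=1..n-1. (c n (k + 1) - c n k) * L2_norm \<Omega> (u k)))
      \<and> 1 / c n n = step_tau \<alpha> t n"
proof
  fix n assume n: "n \<in> {1..N}"
  interpret fe_basis a b r m \<phi>
    using assms by unfold_locales auto
  have V: "u k \<in> fe_space r m a b" if "k \<le> n" for k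
    using that n \<open>\<forall>n\<in>{0..N}. u n \<in> V\<close> unfolding V_def by auto
  have diag: "c n n = 1 / step_tau \<alpha> t n"
    unfolding c_def using n coeff by (intro cbar_diag) auto
  have tn: "0 < t n"
    using n \<open>0 < T\<close> by (auto simp: t_def graded_mesh_def)
  have "0 < t n powr (- \<alpha>) / Gamma (1 - \<alpha>)"
    using tn \<open>\<alpha> < 1\<close> by (intro divide_pos_pos Gamma_real_pos) auto
  hence c1: "0 < c n 1" using lower n by force
  have mono_n: "c n k \<le> c n (k + 1)" if "k \<in> {1..<n}" for k
    using mono n that by blast
  \<comment> \<open>Monotonicity carries the positive lower bound for the first coefficient to the last one.\<close>
  have "c n 1 \<le> c n n"
  proof -
    have "k \<le> n \<longrightarrow> c n 1 \<le> c n k" if "1 \<le> k" for k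
      using that
    proof (induct k rule: nat_induct_at_least)
      case (Suc k)
      thus ?case using mono_n[of k] by force
    qed simp
    thus ?thesis using n by auto
  qed
  hence cn: "0 < c n n" using c1 by simp
  have "L2_norm \<Omega> (u n) \<le> 1 / c n n *
        (L2_norm \<Omega> (\<lambda>x. f x (t n)) + c n 1 * L2_norm \<Omega> (u 0)
          + (\<Sum>k=1..n-1. (c n (k + 1) - c n k) * L2_norm \<Omega> (u k)))"
  proof (rule energy_estimate)
    show "0 \<le> \<kappa> * frac_form \<Omega> \<phi> \<gamma> s (u n) (u n)"
      unfolding \<Omega>_def
      using frac_form_nonneg[OF \<open>0 \<le> \<gamma>\<close> V[of n]] \<open>0 < \<kappa>\<close> by simp
    show "u k \<in> L2_space \<Omega>" if "k \<le> n" for k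
      unfolding \<Omega>_def by (rule fe_space_L2[OF V[OF that]])
    show "L2_inner \<Omega> (\<lambda>x. \<Sum>k=1..n. c n k * (u k x - u (k - 1) x)) (u n)
        + \<kappa> * frac_form \<Omega> \<phi> \<gamma> s (u n) (u n) = L2_inner \<Omega> (\<lambda>x. f x (t n)) (u n)"
      using scheme n V[of n] unfolding V_def by auto
  qed (use n c1 cn mono_n assms in auto)
  moreover have "1 / c n n = step_tau \<alpha> t n" using diag by simp
  ultimately show "L2_norm \<Omega> (u n) \<le> 1 / c n n *
        (L2_norm \<Omega> (\<lambda>x. f x (t n)) + c n 1 * L2_norm \<Omega> (u 0)
          + (\<Sum>k=1..n-1. (c n (k + 1) - c n k) * L2_norm \<Omega> (u k)))
      \<and> 1 / c n n = step_tau \<alpha> t n" by blast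
qed

end
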